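(* Let $X=(X_t)_{t\ge0}$ be a time-homogeneous martingale diffusion satisfying the standing assumptions in the context, with state space $I=(\ell,r)$, starting point $x_0$, diffusion coefficient $\sigma$ and densities $f_t$, $t>0$. Let $a:[0,\infty)\to[0,\infty)$ be a strictly increasing, twice continuously differentiable function with $a(0)=0$ and $\dot a(t)<1$ for $t>0$. Suppose that $$K=\inf_{t>0}\inf_{y\in I}\frac{f_t(y)}{f_{a(t)}(y)}>0,$$ fix $c\in(0,K)$, and for $t>0$ set $h_t(y)=\frac{1}{1-c}\{f_t(y)-c f_{a(t)}(y)\}$. Let $G$ be given by $G_t=X_{a(t)}$, let $H$ be the Dupire diffusion associated with the family of densities $(h_t)_{t>0}$, and let $Z^c$ be a Bernoulli random variable, independent of $G$ and $H$ and known at time $0$, with $\mathbb P(Z^c=1)=c$. Then $$\tilde X_t = G_t\, I_{\{Z^c=1\}} + H_t\, I_{\{Z^c=0\}}, \qquad t\ge0,$$ is a fake version of $X$.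
   Context: Standing assumptions on $X$: $X$ is a martingale solving $dX_t=\sigma(X_t)\,dB_t$, $X_0=x_0$, where $B$ is a Brownian motion. Its state space is $I\subseteq\mathbb R$; the boundary points of $I$ are not attainable, so $I=(\ell,r)$ with $-\infty\le \ell<x_0<r\le\infty$. The function $\sigma$ is positive and continuously differentiable on $I$. For $t>0$ the law $\mu^X_t$ of $X_t$ has a density $f_t(\cdot)$, and $f_t(x)$ is continuously differentiable in both $x$ and $t$. Fake version: a fake version of the martingale $X$ is a continuous martingale $\tilde X=(\tilde X_t)_{t\ge0}$ such that $\tilde X_t$ has the same law $\mu^X_t$ as $X_t$ for every $t\geq 0$, but which is distinct from $X$ (its law as a process is different from that of $X$). Dupire diffusion: given a family of laws $(\mu_t)_{t\ge0}$ increasing in convex order, put $C(t,x)=\int_{\mathbb R}(y-x)^+\mu_t(dy)$ and $\eta(t,y)^2=2\,\frac{\partial C(t,y)}{\partial t}\Big/\frac{\partial^2 C(t,y)}{\partial y^2}$. The Dupire diffusion associated with $(\mu_t)_{t\ge 0}$ is the (time-inhomogeneous) martingale diffusion $Y$ solving $dY_t=\eta(t,Y_t)\,dW_t$, with $W$ a Brownian motion, such that $Y_t$ has law $\mu_t$ for all $t\ge0$. For the family $(h_t)_{t>0}$, $\mu_t$ is the law with density $h_t$ for $t>0$ and $\mu_0=\delta_{x_0}$, the unit mass at $x_0$. "$Z^c$ is known at time $0$" means that $Z^c$ is measurable with respect to the time-$0$ $\sigma$-algebra of the filtration in use. *)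

theory Defs
  imports "HOL-Probability.Probability"
begin

text \<open>
  Processes are functions \<open>X :: real \<Rightarrow> 'a \<Rightarrow> real\<close> of which only the values at times
  \<open>t \<ge> 0\<close> matter. A process is called continuous if all its paths are continuous.
\<close>

definition continuous_paths :: "'a measure \<Rightarrow> (real \<Rightarrow> 'a \<Rightarrow> real) \<Rightarrow> bool" where
  "continuous_paths M X \<longleftrightarrow> (\<forall>\<omega>\<in>space M. continuous_on {0..} (\<lambda>t. X t \<omega>))"

text \<open>
  The library's filtrations are indexed by a whole linear order, here \<open>real\<close>; the sub-sigma-algebras
  at negative times play no role. The usual conditions are not imposed.
\<close>

definition filtration_on :: "'a measure \<Rightarrow> (real \<Rightarrow> 'a measure) \<Rightarrow> bool" where
  "filtration_on M F \<longleftrightarrow> filtration (space M) F \<and> (\<forall>t. subalgebra M (F t))"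

definition martingale :: "'a measure \<Rightarrow> (real \<Rightarrow> 'a measure) \<Rightarrow> (real \<Rightarrow> 'a \<Rightarrow> real) \<Rightarrow> bool" where
  "martingale M F X \<longleftrightarrow> filtration_on M F \<and>
     (\<forall>t\<ge>0. X t \<in> borel_measurable (F t) \<and> integrable M (X t)) \<and>
     (\<forall>s\<ge>0. \<forall>t\<ge>s. AE \<omega> in M. real_cond_exp M (F s) (X t) \<omega> = X s \<omega>)"

definition brownian_motion :: "'a measure \<Rightarrow> (real \<Rightarrow> 'a measure) \<Rightarrow> (real \<Rightarrow> 'a \<Rightarrow> real) \<Rightarrow> bool" where
  "brownian_motion M F B \<longleftrightarrow> filtration_on M F \<and> continuous_paths M B \<and>
     (AE \<omega> in M. B 0 \<omega> = 0) \<and>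
     (\<forall>t\<ge>0. B t \<in> borel_measurable (F t)) \<and>
     (\<forall>s\<ge>0. \<forall>t>s.
        distributed M lborel (\<lambda>\<omega>. B t \<omega> - B s \<omega>) (\<lambda>x. ennreal (normal_density 0 (sqrt (t - s)) x)) \<and>
        prob_space.indep_set M (sets (F s))
          (sets (vimage_algebra (space M) (\<lambda>\<omega>. B t \<omega> - B s \<omega>) borel)))"

text \<open>
  A simple integrand is a finite sum of terms \<open>\<xi> 1\<^bsub>(s,u]\<^esub>\<close> with \<open>\<xi>\<close> bounded and measurable at time \<open>s\<close>;
  it is given by the list of the triples \<open>(s, u, \<xi>)\<close>.
\<close>

type_synonym 'a simple_integrand = "(real \<times> real \<times> ('a \<Rightarrow> real)) list"

definition simple_integrand :: "'a measure \<Rightarrow> (real \<Rightarrow> 'a measure) \<Rightarrow> 'a simple_integrand \<Rightarrow> bool" where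
  "simple_integrand M F S \<longleftrightarrow> (\<forall>(s, u, \<xi>)\<in>set S.
     0 \<le> s \<and> s \<le> u \<and> \<xi> \<in> borel_measurable (F s) \<and> bounded (\<xi> ` space M))"

definition simple_value :: "'a simple_integrand \<Rightarrow> real \<Rightarrow> 'a \<Rightarrow> real" where
  "simple_value S t \<omega> = (\<Sum>(s, u, \<xi>)\<leftarrow>S. \<xi> \<omega> * indicator {s<..u} t)"

definition simple_integral :: "'a simple_integrand \<Rightarrow> (real \<Rightarrow> 'a \<Rightarrow> real) \<Rightarrow> real \<Rightarrow> 'a \<Rightarrow> real" where
  "simple_integral S B t \<omega> = (\<Sum>(s, u, \<xi>)\<leftarrow>S. \<xi> \<omega> * (B (min u t) \<omega> - B (min s t) \<omega>))"

text \<open>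
  \<open>ito_integral M F B \<phi> J\<close>: the process \<open>J\<close> is the stochastic integral of \<open>\<phi>\<close> against the Brownian
  motion \<open>B\<close>, that is, \<open>\<phi>\<close> is progressively measurable and locally square integrable in time,
  \<open>J\<close> is continuous and adapted, and \<open>J\<close> is the limit in probability of the integrals of simple
  integrands \<open>S n\<close> with \<open>\<integral>\<^sub>0\<^sup>T (S n - \<phi>)\<^sup>2 ds \<rightarrow> 0\<close> in probability for all \<open>T\<close>.
  The value \<open>\<phi> 0\<close> is irrelevant, and is deliberately not constrained.
\<close>

definition ito_integral ::
  "'a measure \<Rightarrow> (real \<Rightarrow> 'a measure) \<Rightarrow> (real \<Rightarrow> 'a \<Rightarrow> real) \<Rightarrow> (real \<Rightarrow> 'a \<Rightarrow> real) \<Rightarrow> (real \<Rightarrow> 'a \<Rightarrow> real) \<Rightarrow> bool"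
where
  "ito_integral M F B \<phi> J \<longleftrightarrow>
     (\<forall>T\<ge>0. (\<lambda>(s, \<omega>). \<phi> s \<omega>) \<in> borel_measurable (restrict_space borel {0<..T} \<Otimes>\<^sub>M F T)) \<and>
     (AE \<omega> in M. \<forall>T\<ge>0. (\<integral>\<^sup>+s\<in>{0<..T}. ennreal ((\<phi> s \<omega>)\<^sup>2) \<partial>lborel) < \<infinity>) \<and>
     continuous_paths M J \<and> (\<forall>t\<ge>0. J t \<in> borel_measurable (F t)) \<and>
     (\<exists>S. (\<forall>n. simple_integrand M F (S n)) \<and>
        (\<forall>T\<ge>0. \<forall>\<epsilon>>0.
           (\<lambda>n. measure M {\<omega>\<in>space M.
              (\<integral>\<^sup>+s\<in>{0<..T}. ennreal ((simple_value (S n) s \<omega> - \<phi> s \<omega>)\<^sup>2) \<partial>lborel) > ennreal \<epsilon>})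
             \<longlonglongrightarrow> 0) \<and>
        (\<forall>t\<ge>0. \<forall>\<epsilon>>0.
           (\<lambda>n. measure M {\<omega>\<in>space M. \<bar>simple_integral (S n) B t \<omega> - J t \<omega>\<bar> > \<epsilon>})
             \<longlonglongrightarrow> 0))"

text \<open>\<open>Y\<close> is a continuous martingale with \<open>dY\<^sub>t = \<beta>(t, Y\<^sub>t) dB\<^sub>t\<close>, \<open>B\<close> being an \<open>F\<close>-Brownian motion.\<close>

definition martingale_diffusion ::
  "'a measure \<Rightarrow> (real \<Rightarrow> 'a measure) \<Rightarrow> (real \<Rightarrow> 'a \<Rightarrow> real) \<Rightarrow> (real \<Rightarrow> real \<Rightarrow> real) \<Rightarrow> (real \<Rightarrow> 'a \<Rightarrow> real) \<Rightarrow> bool"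
where
  "martingale_diffusion M F B \<beta> Y \<longleftrightarrow>
     brownian_motion M F B \<and> martingale M F Y \<and> continuous_paths M Y \<and>
     ito_integral M F B (\<lambda>t \<omega>. \<beta> t (Y t \<omega>)) (\<lambda>t \<omega>. Y t \<omega> - Y 0 \<omega>)"

definition C1_jointly_on :: "(real \<times> real) set \<Rightarrow> (real \<Rightarrow> real \<Rightarrow> real) \<Rightarrow> bool" where
  "C1_jointly_on D g \<longleftrightarrow> (\<exists>g\<^sub>t g\<^sub>x.
     (\<forall>(t, x)\<in>D. ((\<lambda>s. g s x) has_real_derivative g\<^sub>t t x) (at t) \<and>
                 ((\<lambda>y. g t y) has_real_derivative g\<^sub>x t x) (at x)) \<and>
     continuous_on D (\<lambda>(t, x). g\<^sub>t t x) \<and> continuous_on D (\<lambda>(t, x). g\<^sub>x t x))"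

text \<open>One-sided derivatives are used at those points of \<open>S\<close> that are not interior.\<close>

definition C2_on :: "real set \<Rightarrow> (real \<Rightarrow> real) \<Rightarrow> bool" where
  "C2_on S g \<longleftrightarrow> (\<exists>g' g''.
     (\<forall>t\<in>S. (g has_real_derivative g' t) (at t within S) \<and>
            (g' has_real_derivative g'' t) (at t within S)) \<and>
     continuous_on S g'')"

definition standing_assumptions ::
  "'a measure \<Rightarrow> (real \<Rightarrow> 'a measure) \<Rightarrow> (real \<Rightarrow> 'a \<Rightarrow> real) \<Rightarrow> ereal \<Rightarrow> ereal \<Rightarrow> real \<Rightarrow> (real \<Rightarrow> real) \<Rightarrow>
   (real \<Rightarrow> real \<Rightarrow> real) \<Rightarrow> (real \<Rightarrow> 'a \<Rightarrow> real) \<Rightarrow> bool"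
where
  "standing_assumptions M F B l r x\<^sub>0 \<sigma> f X \<longleftrightarrow>
     martingale_diffusion M F B (\<lambda>t. \<sigma>) X \<and>
     l < ereal x\<^sub>0 \<and> ereal x\<^sub>0 < r \<and>
     (AE \<omega> in M. X 0 \<omega> = x\<^sub>0) \<and>
     (\<forall>\<omega>\<in>space M. \<forall>t\<ge>0. X t \<omega> \<in> einterval l r) \<and>
     (\<forall>x\<in>einterval l r. \<sigma> x > 0) \<and> \<sigma> C1_differentiable_on einterval l r \<and>
     (\<forall>t>0. \<forall>y\<in>einterval l r. f t y \<ge> 0) \<and>
     (\<forall>t>0. distributed M lborel (X t) (\<lambda>y. ennreal (f t y) * indicator (einterval l r) y)) \<and>
     C1_jointly_on ({0<..} \<times> einterval l r) f"

text \<open>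
  The family of laws belonging to a family \<open>h\<close> of densities on \<open>I\<close>. The value at \<open>t < 0\<close> is
  irrelevant.
\<close>

definition laws_of_densities :: "real set \<Rightarrow> real \<Rightarrow> (real \<Rightarrow> real \<Rightarrow> real) \<Rightarrow> real \<Rightarrow> real measure" where
  "laws_of_densities I x\<^sub>0 h t =
     (if t > 0 then density lborel (\<lambda>y. ennreal (h t y) * indicator I y) else return borel x\<^sub>0)"

definition call_price :: "(real \<Rightarrow> real measure) \<Rightarrow> real \<Rightarrow> real \<Rightarrow> real" where
  "call_price \<mu> t x = (\<integral>y. max 0 (y - x) \<partial>\<mu> t)"

definition dupire_coefficient :: "(real \<Rightarrow> real measure) \<Rightarrow> real \<Rightarrow> real \<Rightarrow> real" where
  "dupire_coefficient \<mu> t y =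
     sqrt (2 * deriv (\<lambda>s. call_price \<mu> s y) t / deriv (deriv (call_price \<mu> t)) y)"

text \<open>
  That \<open>\<mu>\<close> increases in convex order need not be required separately: by Jensen's inequality it is
  implied by the existence of a martingale with these marginals.
\<close>

definition dupire_diffusion :: "'a measure \<Rightarrow> (real \<Rightarrow> real measure) \<Rightarrow> (real \<Rightarrow> 'a \<Rightarrow> real) \<Rightarrow> bool" where
  "dupire_diffusion M \<mu> Y \<longleftrightarrow>
     (\<exists>F W. martingale_diffusion M F W (dupire_coefficient \<mu>) Y) \<and>
     (\<forall>t\<ge>0. distr M borel (Y t) = \<mu> t)"

text \<open>
  The path of a process, as an element of \<open>\<real>\<^bsup>[0,\<infinity>)\<^esup>\<close> with the product sigma-algebra. For processes with
  continuous paths two laws agree there iff they agree on the space of continuous functions.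
\<close>

abbreviation path_space :: "(real \<Rightarrow> real) measure" where
  "path_space \<equiv> (\<Pi>\<^sub>M t\<in>{0..}. borel)"

definition path_of :: "(real \<Rightarrow> 'a \<Rightarrow> real) \<Rightarrow> 'a \<Rightarrow> real \<Rightarrow> real" where
  "path_of X \<omega> = (\<lambda>t\<in>{0..}. X t \<omega>)"

definition process_law :: "'a measure \<Rightarrow> (real \<Rightarrow> 'a \<Rightarrow> real) \<Rightarrow> (real \<Rightarrow> real) measure" where
  "process_law M X = distr M path_space (path_of X)"

text \<open>The filtration of an observer who knows \<open>Z\<close> at time \<open>0\<close> and sees \<open>Y\<close> evolve.\<close>

definition observed_filtration ::
  "'a measure \<Rightarrow> ('a \<Rightarrow> nat) \<Rightarrow> (real \<Rightarrow> 'a \<Rightarrow> real) \<Rightarrow> real \<Rightarrow> 'a measure"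
where
  "observed_filtration M Z Y t =
     vimage_algebra (space M) (\<lambda>\<omega>. (Z \<omega>, \<lambda>s\<in>{0..t}. Y s \<omega>))
       (count_space UNIV \<Otimes>\<^sub>M (\<Pi>\<^sub>M s\<in>{0..t}. borel))"

text \<open>
  \<open>Y\<close> (on \<open>M\<close>) is a fake version of \<open>X\<close> (on \<open>N\<close>), the martingale property of \<open>Y\<close> being with respect
  to \<open>F\<close>; it is then inherited by the natural filtration of \<open>Y\<close>.
\<close>

definition fake_version ::
  "'a measure \<Rightarrow> (real \<Rightarrow> 'a measure) \<Rightarrow> (real \<Rightarrow> 'a \<Rightarrow> real) \<Rightarrow> 'b measure \<Rightarrow> (real \<Rightarrow> 'b \<Rightarrow> real) \<Rightarrow> bool"
where
  "fake_version M F Y N X \<longleftrightarrow>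
     martingale M F Y \<and> continuous_paths M Y \<and>
     (\<forall>t\<ge>0. distr M borel (Y t) = distr N borel (X t)) \<and>
     process_law M Y \<noteq> process_law N X"

end

theory Submission
  imports Defs
begin

text \<open>
  Conditionally on \<open>Z\<close> the process is a martingale, either \<open>G\<close> or \<open>H\<close>, and its marginals are
  \<open>c f\<^bsub>a(t)\<^esub> + (1 - c) h\<^sub>t = f\<^sub>t\<close>; integrating \<open>f\<^sub>t \<ge> K f\<^bsub>a(t)\<^esub>\<close> gives \<open>K \<le> 1\<close>, hence \<open>c < 1\<close>.

  The laws differ because \<open>X\<close> has quadratic variation \<open>\<sigma>(X)\<^sup>2 dt\<close>, while on \<open>{Z = 1}\<close>, an event of
  probability \<open>c > 0\<close>, that of the new process is \<open>a'(t) \<sigma>(G)\<^sup>2 dt\<close> with \<open>a' < 1\<close>; so nothing has to be known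
  about \<open>H\<close> here. To see this with finitely many increments, take \<open>n\<close> steps of length \<open>\<delta>/n\<close> after
  time 1 and let \<open>\<delta> \<rightarrow> 0\<close> for fixed \<open>n\<close>: the stochastic integral is then approximated
  by \<open>\<sigma>(X\<^sub>1)(B - B\<^sub>1)\<close> with an error that is \<open>o(\<surd>\<delta>)\<close> in probability. For \<open>X\<close> the sum of squares,
  divided by \<open>\<delta> \<sigma>(X\<^sub>1)\<^sup>2\<close>, is asymptotically chi-square over \<open>n\<close>, so it exceeds \<open>1 - \<eta>\<close> with probability
  close to 1 for large \<open>n\<close>. For \<open>G\<close>, Markov's inequality bounds that probability away from 1,
  uniformly in \<open>n\<close>.
\<close>

subsection \<open>Brownian increments and simple integrals\<close>

text \<open>The definition of \<open>ito_integral\<close> offers convergence in probability and no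
  moments, so an isometry for the limit is out of reach. Hence the detour through a tail inequality
  of Lenglart type: it bounds the probability of a large integral by that of a large squared
  integrand, survives limits in probability, and combines with path continuity to give the o(sqrt
  \<delta>) error. Roots of sums of squares are compared, since the Euclidean norm, unlike the sum
  of squares, moves by no more than the error of the increments. The reference time is positive
  because \<open>deriv a t < 1\<close> is assumed for t > 0 alone. The factor \<sigma>(X_1) is read
  off from the path itself, so one event can be tested under both laws. The constants are fixed
  before \<open>n\<close>, and \<open>n\<close> before \<delta>; this is why the bound for
  \<open>G\<close> must not depend on \<open>n\<close>. \<open>H\<close> is a martingale in a
  filtration possibly unrelated to that of \<open>X\<close>. What the two share is the martingale
  identity tested on events of their own past, and this form is the one that the mixture
  preserves.\<close>

lemma (in prob_space) indep_set_expectation_mult: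
  fixes U V :: "'a \<Rightarrow> real"
  assumes ind: "indep_set (sets A) (sets B)" and A: "subalgebra M A" and B: "subalgebra M B"
    and U: "U \<in> borel_measurable A" and V: "V \<in> borel_measurable B"
    and iU: "integrable M U" and iV: "integrable M V"
  shows "integrable M (\<lambda>\<omega>. U \<omega> * V \<omega>)"
    and "expectation (\<lambda>\<omega>. U \<omega> * V \<omega>) = expectation U * expectation V"
proof -
  have sp: "space A = space M" "space B = space M"
    using A B by (auto simp: subalgebra_def)
  have "sigma_sets (space M) {U -` S \<inter> space M |S. S \<in> sets borel} \<subseteq> sets A"
    unfolding sp(1)[symmetric] using measurable_sets[OF U] by (intro sets.sigma_sets_subset) auto
  moreover have "sigma_sets (space M) {V -` S \<inter> space M |S. S \<in> sets borel} \<subseteq> sets B"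
    unfolding sp(2)[symmetric] using measurable_sets[OF V] by (intro sets.sigma_sets_subset) auto
  ultimately have "indep_set (sigma_sets (space M) {U -` S \<inter> space M |S. S \<in> sets borel})
     (sigma_sets (space M) {V -` S \<inter> space M |S. S \<in> sets borel})"
    using ind unfolding indep_set_def
    by (elim indep_sets_mono_sets) (auto split: bool.split)
  then have "indep_var borel U borel V"
    using iU iV unfolding indep_var_eq by auto
  then show "integrable M (\<lambda>\<omega>. U \<omega> * V \<omega>)"
    "expectation (\<lambda>\<omega>. U \<omega> * V \<omega>) = expectation U * expectation V"
    using indep_var_integrable indep_var_lebesgue_integral iU iV by auto
qed

lemma (in prob_space) prob_ge_le_second_moment:
  fixes Y :: "'a \<Rightarrow> real"
  assumes "Y \<in> borel_measurable M" "integrable M (\<lambda>\<omega>. (Y \<omega>)\<^sup>2)"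
    and "expectation (\<lambda>\<omega>. (Y \<omega>)\<^sup>2) \<le> C" "0 < \<epsilon>"
  shows "prob {\<omega>\<in>space M. \<bar>Y \<omega>\<bar> \<ge> \<epsilon>} \<le> C / \<epsilon>\<^sup>2"
proof -
  have "{\<omega>\<in>space M. \<bar>Y \<omega>\<bar> \<ge> \<epsilon>} = {\<omega>\<in>space M. (Y \<omega>)\<^sup>2 \<ge> \<epsilon>\<^sup>2}"
    using assms(4) by (auto simp: abs_le_square_iff[symmetric])
  also have "prob \<dots> \<le> expectation (\<lambda>\<omega>. (Y \<omega>)\<^sup>2) / \<epsilon>\<^sup>2"
    using assms by (intro integral_Markov_inequality_measure[where A="{}"]) auto
  also have "\<dots> \<le> C / \<epsilon>\<^sup>2"
    using assms by (intro divide_right_mono) auto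
  finally show ?thesis .
qed

locale brownian = prob_space M for M :: "'a measure" +
  fixes F :: "real \<Rightarrow> 'a measure" and B :: "real \<Rightarrow> 'a \<Rightarrow> real"
  assumes brownian_motion: "brownian_motion M F B"
begin

lemma subalgebra_F: "subalgebra M (F t)"
  using brownian_motion by (auto simp: brownian_motion_def filtration_on_def)

lemma space_F [simp]: "space (F t) = space M"
  using subalgebra_F by (auto simp: subalgebra_def)

lemma measurable_F_mono: "s \<le> t \<Longrightarrow> f \<in> measurable (F s) N \<Longrightarrow> f \<in> measurable (F t) N"
  using brownian_motion filtration.sets_F_mono[of "space M" F s t]
  by (auto simp: brownian_motion_def filtration_on_def measurable_def)

lemma measurable_F: "f \<in> measurable (F s) N \<Longrightarrow> f \<in> measurable M N"
  by (rule measurable_from_subalg[OF subalgebra_F])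

lemma measurable_B: "0 \<le> t \<Longrightarrow> B t \<in> borel_measurable (F t)"
  using brownian_motion by (auto simp: brownian_motion_def)

lemma measurable_B' [measurable]: "0 \<le> t \<Longrightarrow> B t \<in> borel_measurable M"
  by (rule measurable_F[OF measurable_B])

context
  fixes s t :: real
  assumes st: "0 \<le> s" "s < t"
begin

lemma increment_distributed:
  "distributed M lborel (\<lambda>\<omega>. B t \<omega> - B s \<omega>) (\<lambda>x. ennreal (normal_density 0 (sqrt (t - s)) x))"
  using brownian_motion st by (auto simp: brownian_motion_def)

lemma increment_integrable_power: "integrable M (\<lambda>\<omega>. (B t \<omega> - B s \<omega>) ^ k)"
  using distributed_integrable[OF increment_distributed, of "\<lambda>x. x ^ k"] st
    integrable_normal_moment[of "sqrt (t - s)" 0 k] by simp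

lemma increment_mean: "expectation (\<lambda>\<omega>. B t \<omega> - B s \<omega>) = 0"
  using normal_distributed_expectation[OF _ increment_distributed] st by simp

lemma increment_square: "expectation (\<lambda>\<omega>. (B t \<omega> - B s \<omega>)\<^sup>2) = t - s"
  using distributed_integral[OF increment_distributed, of "\<lambda>x. x\<^sup>2"] st
    integral_normal_moment_even[of "sqrt (t - s)" 0 1]
  by (simp add: fact_numeral)

text \<open>The Gaussian constant is 3 = 4!/(2^2 2!). It enters through Var(D^2) = 3h^2 - h^2 = 2h^2
  for an increment D over a step h.\<close>

lemma increment_fourth_moment: "expectation (\<lambda>\<omega>. (B t \<omega> - B s \<omega>) ^ 4) = 3 * (t - s)\<^sup>2"
  using distributed_integral[OF increment_distributed, of "\<lambda>x. x ^ 4"] st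
    integral_normal_moment_even[of "sqrt (t - s)" 0 2]
  by (simp add: fact_numeral power2_eq_square)

text \<open>The increment generates a sigma-algebra independent of \<open>F s\<close>, in which any
  Borel function \<open>g\<close> of it stays measurable. The instances used are the identity (cross
  terms), the square (isometry) and the centred square (variance of the sum of squares).\<close>

lemma increment_indep:
  fixes U :: "'a \<Rightarrow> real" and g :: "real \<Rightarrow> real"
  assumes U: "U \<in> borel_measurable (F s)" "integrable M U"
    and g: "g \<in> borel_measurable borel" "integrable M (\<lambda>\<omega>. g (B t \<omega> - B s \<omega>))"
  shows "integrable M (\<lambda>\<omega>. U \<omega> * g (B t \<omega> - B s \<omega>))"
    and "expectation (\<lambda>\<omega>. U \<omega> * g (B t \<omega> - B s \<omega>)) =
      expectation U * expectation (\<lambda>\<omega>. g (B t \<omega> - B s \<omega>))"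
proof -
  let ?V = "vimage_algebra (space M) (\<lambda>\<omega>. B t \<omega> - B s \<omega>) borel"
  have ind: "indep_set (sets (F s)) (sets ?V)"
    using brownian_motion st by (auto simp: brownian_motion_def)
  have m: "(\<lambda>\<omega>. B t \<omega> - B s \<omega>) \<in> borel_measurable ?V"
    by (rule measurable_vimage_algebra1) auto
  have sV: "subalgebra M ?V"
    using indep_setD_ev2[OF ind] by (auto simp: subalgebra_def)
  have "(\<lambda>\<omega>. g (B t \<omega> - B s \<omega>)) \<in> borel_measurable ?V"
    using measurable_compose[OF m g(1)] .
  from indep_set_expectation_mult[OF ind subalgebra_F sV U(1) this U(2) g(2)]
  show "integrable M (\<lambda>\<omega>. U \<omega> * g (B t \<omega> - B s \<omega>))"
    "expectation (\<lambda>\<omega>. U \<omega> * g (B t \<omega> - B s \<omega>)) =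
      expectation U * expectation (\<lambda>\<omega>. g (B t \<omega> - B s \<omega>))" by auto
qed

end

text \<open>Orthogonality of increments: \<open>Y k \<omega> * \<xi> k \<omega>\<close> is known at
  time \<open>p k\<close>, and the next increment is independent of it with mean zero, so the cross
  term of the square drops out. Measurability of the partial sum and integrability of its square
  travel with the induction because the next factorization asks for them.\<close>

lemma ito_isometry_discrete:
  fixes p :: "nat \<Rightarrow> real" and \<xi> :: "nat \<Rightarrow> 'a \<Rightarrow> real" and N :: nat
  defines "Y \<equiv> \<lambda>k \<omega>. \<Sum>i<k. \<xi> i \<omega> * (B (p (Suc i)) \<omega> - B (p i) \<omega>)"
  assumes p0: "0 \<le> p 0" and p: "\<And>i. i < N \<Longrightarrow> p i < p (Suc i)"
    and \<xi>: "\<And>i. i < N \<Longrightarrow> \<xi> i \<in> borel_measurable (F (p i))"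
    and bnd: "\<And>i. i < N \<Longrightarrow> \<exists>C. \<forall>\<omega>\<in>space M. \<bar>\<xi> i \<omega>\<bar> \<le> C"
  shows "k \<le> N \<Longrightarrow> 0 \<le> p k \<and> Y k \<in> borel_measurable (F (p k)) \<and> integrable M (\<lambda>\<omega>. (Y k \<omega>)\<^sup>2) \<and>
    expectation (\<lambda>\<omega>. (Y k \<omega>)\<^sup>2) = expectation (\<lambda>\<omega>. \<Sum>i<k. (\<xi> i \<omega>)\<^sup>2 * (p (Suc i) - p i))"
proof (induction k)
  case 0
  then show ?case using p0 by (simp add: Y_def)
next
  case (Suc k)
  then have k: "k < N" by simp
  define D where "D = (\<lambda>\<omega>. B (p (Suc k)) \<omega> - B (p k) \<omega>)"
  have pk: "0 \<le> p k" and pk': "p k < p (Suc k)" and Ym: "Y k \<in> borel_measurable (F (p k))"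
    and Yi: "integrable M (\<lambda>\<omega>. (Y k \<omega>)\<^sup>2)"
    and YE: "expectation (\<lambda>\<omega>. (Y k \<omega>)\<^sup>2) = expectation (\<lambda>\<omega>. \<Sum>i<k. (\<xi> i \<omega>)\<^sup>2 * (p (Suc i) - p i))"
    using Suc k p by auto
  have Ym' [measurable]: "Y k \<in> borel_measurable M" by (rule measurable_F[OF Ym])
  have xm: "\<xi> i \<in> borel_measurable M" if "i < N" for i
    using \<xi>[OF that] measurable_F by auto
  note [measurable] = xm[OF k]
  have xi: "integrable M (\<lambda>\<omega>. (\<xi> i \<omega>)\<^sup>2)" if i: "i < N" for i
  proof -
    obtain C where C: "\<forall>\<omega>\<in>space M. \<bar>\<xi> i \<omega>\<bar> \<le> C" using bnd[OF i] by auto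
    have "AE \<omega> in M. norm ((\<xi> i \<omega>)\<^sup>2) \<le> C\<^sup>2"
      using C power_mono[of "\<bar>\<xi> i _\<bar>" C 2] by auto
    with xm[OF i] show ?thesis by (intro integrable_const_bound) auto
  qed
  obtain C where C: "\<And>\<omega>. \<omega> \<in> space M \<Longrightarrow> \<bar>\<xi> k \<omega>\<bar> \<le> C" using bnd[OF k] by auto
  have "integrable M (Y k)"
    using square_integrable_imp_integrable[OF Ym' Yi] .
  then have "integrable M (\<lambda>\<omega>. C * Y k \<omega>)" by simp
  then have Yxi: "integrable M (\<lambda>\<omega>. Y k \<omega> * \<xi> k \<omega>)"
  proof (rule Bochner_Integration.integrable_bound)
    show "AE \<omega> in M. norm (Y k \<omega> * \<xi> k \<omega>) \<le> norm (C * Y k \<omega>)"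
      using C by (auto simp: abs_mult mult.commute[of "\<bar>Y k _\<bar>"] intro!: mult_right_mono order_trans[OF C])
  qed simp
  have Yxm: "(\<lambda>\<omega>. Y k \<omega> * \<xi> k \<omega>) \<in> borel_measurable (F (p k))"
    using Ym \<xi>[OF k] by simp
  note 1 = increment_indep[OF pk pk' Yxm Yxi, of "\<lambda>x. x"]
  have xm2: "(\<lambda>\<omega>. (\<xi> k \<omega>)\<^sup>2) \<in> borel_measurable (F (p k))"
    using \<xi>[OF k] by simp
  note 2 = increment_indep[OF pk pk' xm2 xi[OF k], of "\<lambda>x. x\<^sup>2"]
  have i1: "integrable M (\<lambda>\<omega>. Y k \<omega> * \<xi> k \<omega> * D \<omega>)"
    using 1(1) increment_integrable_power[OF pk pk', of 1] by (simp add: D_def)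
  have e1: "expectation (\<lambda>\<omega>. Y k \<omega> * \<xi> k \<omega> * D \<omega>) = 0"
    using 1(2) increment_integrable_power[OF pk pk', of 1] increment_mean[OF pk pk'] by (simp add: D_def)
  have i2: "integrable M (\<lambda>\<omega>. (\<xi> k \<omega>)\<^sup>2 * (D \<omega>)\<^sup>2)"
    using 2(1) increment_integrable_power[OF pk pk', of 2] by (simp add: D_def)
  have e2: "expectation (\<lambda>\<omega>. (\<xi> k \<omega>)\<^sup>2 * (D \<omega>)\<^sup>2) = expectation (\<lambda>\<omega>. (\<xi> k \<omega>)\<^sup>2) * (p (Suc k) - p k)"
    using 2(2) increment_integrable_power[OF pk pk', of 2] increment_square[OF pk pk'] by (simp add: D_def)
  have YS: "Y (Suc k) = (\<lambda>\<omega>. Y k \<omega> + \<xi> k \<omega> * D \<omega>)"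
    by (auto simp: Y_def D_def)
  have sq: "(\<lambda>\<omega>. (Y (Suc k) \<omega>)\<^sup>2) = (\<lambda>\<omega>. (Y k \<omega>)\<^sup>2 + (2 * (Y k \<omega> * \<xi> k \<omega> * D \<omega>) + (\<xi> k \<omega>)\<^sup>2 * (D \<omega>)\<^sup>2))"
    by (simp add: YS power2_sum power_mult_distrib algebra_simps)
  have "B (p (Suc k)) \<in> borel_measurable (F (p (Suc k)))" "B (p k) \<in> borel_measurable (F (p (Suc k)))"
    using measurable_F_mono[OF less_imp_le[OF pk'] measurable_B[OF pk]] pk pk' measurable_B by auto
  moreover have "Y k \<in> borel_measurable (F (p (Suc k)))" "\<xi> k \<in> borel_measurable (F (p (Suc k)))"
    using measurable_F_mono[OF less_imp_le[OF pk']] Ym \<xi>[OF k] by auto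
  ultimately have "Y (Suc k) \<in> borel_measurable (F (p (Suc k)))"
    unfolding YS D_def by measurable
  moreover have "integrable M (\<lambda>\<omega>. (Y (Suc k) \<omega>)\<^sup>2)"
    unfolding sq using Yi i1 i2 by simp
  moreover have "expectation (\<lambda>\<omega>. (Y (Suc k) \<omega>)\<^sup>2) =
      expectation (\<lambda>\<omega>. \<Sum>i<Suc k. (\<xi> i \<omega>)\<^sup>2 * (p (Suc i) - p i))"
  proof -
    have "integrable M (\<lambda>\<omega>. \<Sum>i<k. (\<xi> i \<omega>)\<^sup>2 * (p (Suc i) - p i))"
      using xi k by (intro Bochner_Integration.integrable_sum) auto
    then show ?thesis
      unfolding sq using Yi i1 i2 e1 e2 YE xi[OF k] by simp
  qed
  ultimately show ?case using pk pk' by auto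
qed

text \<open>The integrand is switched off once the accumulated squares exceed \<open>\<kappa>\<close>; this changes the sum
  only on the first event on the right, and makes the second moment at most \<open>\<kappa>\<close>.\<close>

lemma lenglart_discrete:
  fixes p :: "nat \<Rightarrow> real" and \<xi> :: "nat \<Rightarrow> 'a \<Rightarrow> real" and N :: nat
  assumes p0: "0 \<le> p 0" and p: "\<And>i. i < N \<Longrightarrow> p i < p (Suc i)"
    and \<xi>: "\<And>i. i < N \<Longrightarrow> \<xi> i \<in> borel_measurable (F (p i))"
    and "0 < \<kappa>" "0 < \<epsilon>"
  shows "prob {\<omega>\<in>space M. \<bar>\<Sum>i<N. \<xi> i \<omega> * (B (p (Suc i)) \<omega> - B (p i) \<omega>)\<bar> > \<epsilon>} \<le>
    prob {\<omega>\<in>space M. (\<Sum>i<N. (\<xi> i \<omega>)\<^sup>2 * (p (Suc i) - p i)) > \<kappa>} + \<kappa> / \<epsilon>\<^sup>2"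
proof -
  define A where "A = (\<lambda>k \<omega>. \<Sum>i<k. (\<xi> i \<omega>)\<^sup>2 * (p (Suc i) - p i))"
  \<comment> \<open>The test uses \<open>A (Suc i)\<close>, not \<open>A i\<close>: the extra term
    involves \<open>\<xi> i\<close>, which is known at \<open>p i\<close>, so \<zeta> stays adapted,
    and the accumulated squares of \<zeta> never overshoot \<kappa>.\<close>
  define \<zeta> where "\<zeta> = (\<lambda>i \<omega>. if A (Suc i) \<omega> \<le> \<kappa> then \<xi> i \<omega> else 0)"
  have pmono: "j \<le> N \<Longrightarrow> i \<le> j \<Longrightarrow> p i \<le> p j" for i j
  proof (induction j)
    case (Suc j)
    then show ?case using p[of j] by (cases "i = Suc j") auto
  qed simp
  have xm: "\<xi> j \<in> borel_measurable (F (p i))" if "j \<le> i" "i < N" for i j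
    using measurable_F_mono[OF pmono[of i j] \<xi>[of j]] that by auto
  have Am: "A (Suc i) \<in> borel_measurable (F (p i))" if "i < N" for i
    unfolding A_def using xm that by (intro borel_measurable_sum) auto
  have \<zeta>m: "\<zeta> i \<in> borel_measurable (F (p i))" if "i < N" for i
    unfolding \<zeta>_def using Am[OF that] \<xi>[OF that] by simp
  have Amono: "A i \<omega> \<le> A j \<omega>" if "i \<le> j" "j \<le> N" for i j \<omega>
    unfolding A_def using that p by (intro sum_mono2) (auto intro!: mult_nonneg_nonneg simp: less_imp_le)
  \<comment> \<open>The isometry asks for bounded coefficients while \<xi> is arbitrary; the switch
    supplies the bound, as a surviving term alone contributes at most \<kappa>.\<close>
  have bnd: "\<bar>\<zeta> i \<omega>\<bar> \<le> sqrt (\<kappa> / (p (Suc i) - p i))" if "i < N" for i \<omega>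
  proof (cases "A (Suc i) \<omega> \<le> \<kappa>")
    case True
    have "(\<xi> i \<omega>)\<^sup>2 * (p (Suc i) - p i) \<le> A (Suc i) \<omega>"
      using Amono[of 0 i \<omega>] that by (auto simp: A_def)
    with True have "(\<xi> i \<omega>)\<^sup>2 * (p (Suc i) - p i) \<le> \<kappa>" by simp
    then have "(\<xi> i \<omega>)\<^sup>2 \<le> \<kappa> / (p (Suc i) - p i)"
      using p[OF that] by (simp add: field_simps)
    then show ?thesis using True by (simp add: \<zeta>_def real_le_rsqrt)
  qed (use p[OF that] \<open>0 < \<kappa>\<close> in \<open>auto simp: \<zeta>_def\<close>)
  have A\<zeta>: "(\<Sum>i<k. (\<zeta> i \<omega>)\<^sup>2 * (p (Suc i) - p i)) \<le> \<kappa>" if "k \<le> N" for k \<omega>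
    using that
  proof (induction k)
    case (Suc k)
    show ?case
    proof (cases "A (Suc k) \<omega> \<le> \<kappa>")
      case True
      then have "\<zeta> i \<omega> = \<xi> i \<omega>" if "i < Suc k" for i
        using Amono[of "Suc i" "Suc k" \<omega>] Suc.prems that by (auto simp: \<zeta>_def)
      then show ?thesis using True by (auto simp: A_def)
    next
      case False
      then show ?thesis using Suc by (auto simp: \<zeta>_def)
    qed
  qed (use \<open>0 < \<kappa>\<close> in auto)
  define Y where "Y = (\<lambda>\<omega>. \<Sum>i<N. \<zeta> i \<omega> * (B (p (Suc i)) \<omega> - B (p i) \<omega>))"
  define X where "X = (\<lambda>\<omega>. \<Sum>i<N. \<xi> i \<omega> * (B (p (Suc i)) \<omega> - B (p i) \<omega>))"
  have iso: "Y \<in> borel_measurable (F (p N))" "integrable M (\<lambda>\<omega>. (Y \<omega>)\<^sup>2)"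
    "expectation (\<lambda>\<omega>. (Y \<omega>)\<^sup>2) = expectation (\<lambda>\<omega>. \<Sum>i<N. (\<zeta> i \<omega>)\<^sup>2 * (p (Suc i) - p i))"
    using ito_isometry_discrete[of p N \<zeta>, OF p0 p \<zeta>m _ order_refl] bnd unfolding Y_def by blast+
  have Ym [measurable]: "Y \<in> borel_measurable M" by (rule measurable_F[OF iso(1)])
  have [measurable]: "A N \<in> borel_measurable M"
    unfolding A_def using measurable_F[OF \<xi>] by (intro borel_measurable_sum) auto
  have \<zeta>m': "\<zeta> i \<in> borel_measurable M" if "i < N" for i
    by (rule measurable_F[OF \<zeta>m[OF that]])
  have "integrable M (\<lambda>\<omega>. \<Sum>i<N. (\<zeta> i \<omega>)\<^sup>2 * (p (Suc i) - p i))"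
  proof (rule integrable_const_bound)
    have "0 \<le> (\<Sum>i<N. (\<zeta> i \<omega>)\<^sup>2 * (p (Suc i) - p i))" for \<omega>
      using p by (intro sum_nonneg mult_nonneg_nonneg) (auto simp: less_imp_le)
    then show "AE \<omega> in M. norm (\<Sum>i<N. (\<zeta> i \<omega>)\<^sup>2 * (p (Suc i) - p i)) \<le> \<kappa>"
      using A\<zeta>[of N] by simp
  qed (use \<zeta>m' in \<open>auto intro!: borel_measurable_sum\<close>)
  then have "expectation (\<lambda>\<omega>. \<Sum>i<N. (\<zeta> i \<omega>)\<^sup>2 * (p (Suc i) - p i)) \<le> expectation (\<lambda>\<omega>. \<kappa>)"
    using A\<zeta>[of N] by (intro integral_mono) auto
  then have Y2: "prob {\<omega>\<in>space M. \<bar>Y \<omega>\<bar> \<ge> \<epsilon>} \<le> \<kappa> / \<epsilon>\<^sup>2"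
    using iso \<open>0 < \<epsilon>\<close> by (intro prob_ge_le_second_moment) (auto simp: prob_space)
  have "X \<omega> = Y \<omega>" if "A N \<omega> \<le> \<kappa>" for \<omega>
  proof -
    have "\<zeta> i \<omega> = \<xi> i \<omega>" if "i < N" for i
      using Amono[of "Suc i" N \<omega>] that \<open>A N \<omega> \<le> \<kappa>\<close> by (auto simp: \<zeta>_def)
    then show ?thesis by (auto simp: X_def Y_def)
  qed
  then have "{\<omega>\<in>space M. \<bar>X \<omega>\<bar> > \<epsilon>} \<subseteq> {\<omega>\<in>space M. A N \<omega> > \<kappa>} \<union> {\<omega>\<in>space M. \<bar>Y \<omega>\<bar> \<ge> \<epsilon>}"
    by (auto simp: not_less) (metis less_imp_le not_less)
  then have "prob {\<omega>\<in>space M. \<bar>X \<omega>\<bar> > \<epsilon>} \<le>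
      prob ({\<omega>\<in>space M. A N \<omega> > \<kappa>} \<union> {\<omega>\<in>space M. \<bar>Y \<omega>\<bar> \<ge> \<epsilon>})"
    by (intro finite_measure_mono) auto
  also have "\<dots> \<le> prob {\<omega>\<in>space M. A N \<omega> > \<kappa>} + prob {\<omega>\<in>space M. \<bar>Y \<omega>\<bar> \<ge> \<epsilon>}"
    by (intro measure_Un_le) auto
  also have "\<dots> \<le> prob {\<omega>\<in>space M. A N \<omega> > \<kappa>} + \<kappa> / \<epsilon>\<^sup>2" using Y2 by simp
  finally show ?thesis by (simp add: X_def A_def)
qed

end

section \<open>Partitions adapted to the break points of a simple integrand\<close>

lemma finite_breakpoints_partition:
  fixes E :: "real set"
  assumes "finite E" "s < t"
  shows "\<exists>p N. p 0 = s \<and> p N = t \<and> (\<forall>i<N. p i < p (Suc i)) \<and>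
    (\<forall>i<N. \<forall>e\<in>E. e \<le> p i \<or> p (Suc i) \<le> e)"
  using assms(2)
proof (induction "card (E \<inter> {s<..<t})" arbitrary: s rule: less_induct)
  case less
  show ?case
  proof (cases "E \<inter> {s<..<t} = {}")
    case True
    then show ?thesis
      using less.prems
      by (intro exI[of _ "\<lambda>i. if i = 0 then s else t"] exI[of _ "1"])
         (auto simp: disjoint_iff not_less)
  next
    case False
    \<comment> \<open>Splitting off the smallest point of \<open>E\<close> inside the interval
      leaves fewer such points, which is what the induction counts; \<open>case_nat s p\<close> then
      prepends the old left end.\<close>
    define m where "m = Min (E \<inter> {s<..<t})"
    have fin: "finite (E \<inter> {s<..<t})" using assms(1) by simp
    have m: "m \<in> E" "s < m" "m < t" using Min_in[OF fin False] by (auto simp: m_def)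
    have least: "e \<le> s \<or> m \<le> e" if "e \<in> E" for e
      using Min_le[OF fin, of e] that m by (cases "s < e \<and> e < t") (auto simp: m_def)
    have "E \<inter> {m<..<t} \<subset> E \<inter> {s<..<t}" using m by auto
    then have "card (E \<inter> {m<..<t}) < card (E \<inter> {s<..<t})"
      by (rule psubset_card_mono[OF fin])
    from less.hyps[OF this m(3)] obtain p N where p: "p 0 = m" "p N = t"
      "\<forall>i<N. p i < p (Suc i)" "\<forall>i<N. \<forall>e\<in>E. e \<le> p i \<or> p (Suc i) \<le> e" by auto
    show ?thesis
      using p m least
      by (intro exI[of _ "case_nat s p"] exI[of _ "Suc N"]) (auto simp: less_Suc_eq_0_disj, blast)
  qed
qed

lemma borel_measurable_simple_value:
  "(\<lambda>u. simple_value S u \<omega>) \<in> borel_measurable borel"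
  unfolding simple_value_def by (induction S) (auto simp: split_beta)

text \<open>A left-open, right-closed interval with no end strictly between \<open>p\<close> and
  \<open>q\<close> contains all of (p, q] or none of it, so the right end \<open>q\<close>
  represents the whole step.\<close>

lemma simple_value_const:
  assumes "\<And>a b \<xi>. (a, b, \<xi>) \<in> set S \<Longrightarrow> (a \<le> p \<or> q \<le> a) \<and> (b \<le> p \<or> q \<le> b)"
    and "p < u" "u \<le> q"
  shows "simple_value S u \<omega> = simple_value S q \<omega>"
  using assms(1)
proof (induction S)
  case (Cons x S)
  obtain a b \<xi> where x: "x = (a, b, \<xi>)" by (cases x) auto
  have "(a \<le> p \<or> q \<le> a) \<and> (b \<le> p \<or> q \<le> b)" using Cons.prems[of a b \<xi>] x by auto
  then have "indicator {a<..b} u = (indicator {a<..b} q :: real)"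
    using assms(2,3) by (auto simp: indicator_def)
  moreover have "simple_value S u \<omega> = simple_value S q \<omega>"
    using Cons.prems by (intro Cons.IH) auto
  ultimately show ?case by (simp add: simple_value_def x)
qed (simp add: simple_value_def)

text \<open>A stopped end stays put if it is at most \<open>p\<close> and moves from
  \<open>p\<close> to \<open>q\<close> if it is at least \<open>q\<close>. The assumption
  \<open>a \<le> b\<close> matters: a reversed pair around the step would contribute minus the
  increment although its indicator is zero.\<close>

lemma simple_integral_step:
  assumes "\<And>a b \<xi>. (a, b, \<xi>) \<in> set S \<Longrightarrow> (a \<le> p \<or> q \<le> a) \<and> (b \<le> p \<or> q \<le> b)"
    and "\<And>a b \<xi>. (a, b, \<xi>) \<in> set S \<Longrightarrow> a \<le> b"
    and "p < q"
  shows "simple_integral S B q \<omega> - simple_integral S B p \<omega> =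
    simple_value S q \<omega> * (B q \<omega> - B p \<omega>)"
  using assms(1,2)
proof (induction S)
  case (Cons x S)
  obtain a b \<xi> where x: "x = (a, b, \<xi>)" by (cases x) auto
  have ab: "(a \<le> p \<or> q \<le> a) \<and> (b \<le> p \<or> q \<le> b)" "a \<le> b"
    using Cons.prems[of a b \<xi>] x by auto
  have "(B (min b q) \<omega> - B (min a q) \<omega>) - (B (min b p) \<omega> - B (min a p) \<omega>) =
      indicator {a<..b} q * (B q \<omega> - B p \<omega>)"
    using ab assms(3) by (auto simp: indicator_def min_def)
  then have "\<xi> \<omega> * (B (min b q) \<omega> - B (min a q) \<omega>) - \<xi> \<omega> * (B (min b p) \<omega> - B (min a p) \<omega>) =
      \<xi> \<omega> * (indicator {a<..b} q * (B q \<omega> - B p \<omega>))"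
    by (simp add: right_diff_distrib[symmetric])
  moreover have "simple_integral S B q \<omega> - simple_integral S B p \<omega> =
      simple_value S q \<omega> * (B q \<omega> - B p \<omega>)"
    using Cons.prems by (intro Cons.IH) (meson list.set_intros(2))+
  ultimately show ?case by (simp add: simple_value_def simple_integral_def x algebra_simps)
qed (simp add: simple_value_def simple_integral_def)

text \<open>On each grid step the integrand has its right-end value, so the time integral becomes
  the sum that \<open>lenglart_discrete\<close> controls. The part \<open>p 0 \<le> p k\<close> is
  carried along to write consecutive steps as a disjoint union.\<close>

lemma nn_integral_simple_value:
  assumes p: "\<And>i. i < N \<Longrightarrow> p i < p (Suc i)"
    and S: "\<And>i a b \<xi>. i < N \<Longrightarrow> (a, b, \<xi>) \<in> set S \<Longrightarrow>
      (a \<le> p i \<or> p (Suc i) \<le> a) \<and> (b \<le> p i \<or> p (Suc i) \<le> b)"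
  shows "k \<le> N \<Longrightarrow> p 0 \<le> p k \<and>
    (\<integral>\<^sup>+u\<in>{p 0<..p k}. ennreal ((simple_value S u \<omega>)\<^sup>2) \<partial>lborel) =
    ennreal (\<Sum>i<k. (simple_value S (p (Suc i)) \<omega>)\<^sup>2 * (p (Suc i) - p i))"
proof (induction k)
  case (Suc k)
  then have k: "k < N" by simp
  let ?g = "\<lambda>u. ennreal ((simple_value S u \<omega>)\<^sup>2)"
  note [measurable] = borel_measurable_simple_value[of S \<omega>]
  have le: "p 0 \<le> p k" "p k < p (Suc k)" using Suc p[OF k] by auto
  then have un: "{p 0<..p (Suc k)} = {p 0<..p k} \<union> {p k<..p (Suc k)}"
    and disj: "{p 0<..p k} \<inter> {p k<..p (Suc k)} = {}" by auto
  have "(\<integral>\<^sup>+u\<in>{p 0<..p (Suc k)}. ?g u \<partial>lborel) =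
      (\<integral>\<^sup>+u\<in>{p 0<..p k}. ?g u \<partial>lborel) + (\<integral>\<^sup>+u\<in>{p k<..p (Suc k)}. ?g u \<partial>lborel)"
    unfolding un by (rule nn_integral_disjoint_pair[OF _ _ _ disj]) measurable
  also have "(\<integral>\<^sup>+u\<in>{p k<..p (Suc k)}. ?g u \<partial>lborel) =
      (\<integral>\<^sup>+u. ?g (p (Suc k)) * indicator {p k<..p (Suc k)} u \<partial>lborel)"
  proof (rule nn_integral_cong)
    fix u
    show "?g u * indicator {p k<..p (Suc k)} u = ?g (p (Suc k)) * indicator {p k<..p (Suc k)} u"
    proof (cases "u \<in> {p k<..p (Suc k)}")
      case True
      then have "simple_value S u \<omega> = simple_value S (p (Suc k)) \<omega>"
        using S[OF k] by (intro simple_value_const[of S "p k"]) auto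
      then show ?thesis by (simp only:)
    qed simp
  qed
  also have "\<dots> = ennreal ((simple_value S (p (Suc k)) \<omega>)\<^sup>2 * (p (Suc k) - p k))"
    using le by (simp add: nn_integral_cmult_indicator ennreal_mult)
  also have "(\<integral>\<^sup>+u\<in>{p 0<..p k}. ?g u \<partial>lborel) =
      ennreal (\<Sum>i<k. (simple_value S (p (Suc i)) \<omega>)\<^sup>2 * (p (Suc i) - p i))"
    using Suc by auto
  also have "\<dots> + ennreal ((simple_value S (p (Suc k)) \<omega>)\<^sup>2 * (p (Suc k) - p k)) =
      ennreal (\<Sum>i<Suc k. (simple_value S (p (Suc i)) \<omega>)\<^sup>2 * (p (Suc i) - p i))"
    using le p k by (subst ennreal_plus[symmetric]) (auto intro!: sum_nonneg simp: less_imp_le)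
  finally show ?case using le by auto
qed simp

context brownian
begin

text \<open>Predictability: a term active at \<open>q\<close> starts before \<open>q\<close>, hence
  by \<open>p\<close>, so its coefficient is known at \<open>p\<close>; terms starting at
  \<open>q\<close> or later vanish there.\<close>

lemma simple_value_measurable:
  assumes "\<And>a b \<xi>. (a, b, \<xi>) \<in> set S \<Longrightarrow> \<xi> \<in> borel_measurable (F a)"
    and "\<And>a b \<xi>. (a, b, \<xi>) \<in> set S \<Longrightarrow> a \<le> p \<or> q \<le> a"
  shows "simple_value S q \<in> borel_measurable (F p)"
  using assms
proof (induction S)
  case (Cons x S)
  obtain a b \<xi> where x: "x = (a, b, \<xi>)" by (cases x) auto
  have 1: "simple_value S q \<in> borel_measurable (F p)"
    using Cons.prems by (intro Cons.IH) (meson list.set_intros(2))+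
  have 2: "(\<lambda>\<omega>. \<xi> \<omega> * indicator {a<..b} q) \<in> borel_measurable (F p)"
  proof (cases "a \<le> p")
    case True
    have "\<xi> \<in> borel_measurable (F a)"
      by (rule Cons.prems(1)[of a b]) (simp add: x)
    from measurable_F_mono[OF True this] show ?thesis
      by (intro borel_measurable_times borel_measurable_const)
  next
    case False
    then have "indicator {a<..b} q = (0::real)"
      using Cons.prems(2)[of a b \<xi>, unfolded x, OF list.set_intros(1)] by simp
    then show ?thesis by simp
  qed
  have "simple_value (x # S) q = (\<lambda>\<omega>. \<xi> \<omega> * indicator {a<..b} q + simple_value S q \<omega>)"
    by (auto simp: simple_value_def x)
  then show ?case using borel_measurable_add[OF 2 1] by (simp only:)
qed (simp add: simple_value_def[abs_def])

text \<open>On a grid through all break points the increment of the integral is a discrete sum with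
  coefficients known at left ends, so \<open>lenglart_discrete\<close> applies. The coefficients may
  be unbounded, which later lets a random factor such as \<sigma>(X_s) be inserted as an extra
  term.\<close>

lemma simple_integral_tail:
  assumes S: "\<And>a b \<xi>. (a, b, \<xi>) \<in> set S \<Longrightarrow> a \<le> b \<and> \<xi> \<in> borel_measurable (F a)"
    and st: "0 \<le> s" "s < t" and pos: "0 < \<kappa>" "0 < \<epsilon>"
  shows "prob {\<omega>\<in>space M. \<bar>simple_integral S B t \<omega> - simple_integral S B s \<omega>\<bar> > \<epsilon>} \<le>
    prob {\<omega>\<in>space M. (\<integral>\<^sup>+u\<in>{s<..t}. ennreal ((simple_value S u \<omega>)\<^sup>2) \<partial>lborel) > ennreal \<kappa>} + \<kappa> / \<epsilon>\<^sup>2"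
proof -
  let ?E = "fst ` set S \<union> (\<lambda>x. fst (snd x)) ` set S"
  have "finite ?E" by auto
  from finite_breakpoints_partition[OF this st(2)] obtain p N where
    p0: "p 0 = s" "p N = t" and p: "\<And>i. i < N \<Longrightarrow> p i < p (Suc i)"
    and E: "\<And>i e. i < N \<Longrightarrow> e \<in> ?E \<Longrightarrow> e \<le> p i \<or> p (Suc i) \<le> e"
    by (auto 0 3)
  have br: "(a \<le> p i \<or> p (Suc i) \<le> a) \<and> (b \<le> p i \<or> p (Suc i) \<le> b)"
    if "i < N" "(a, b, \<xi>) \<in> set S" for i a b \<xi>
    using E[of i a] E[of i b] that by force
  have m: "simple_value S (p (Suc i)) \<in> borel_measurable (F (p i))" if "i < N" for i
    using S br[OF that] by (intro simple_value_measurable) blast+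
  have "simple_integral S B t \<omega> - simple_integral S B s \<omega> =
      (\<Sum>i<N. simple_value S (p (Suc i)) \<omega> * (B (p (Suc i)) \<omega> - B (p i) \<omega>))" for \<omega>
  proof -
    have "simple_integral S B t \<omega> - simple_integral S B s \<omega> =
        (\<Sum>i<N. simple_integral S B (p (Suc i)) \<omega> - simple_integral S B (p i) \<omega>)"
      by (subst sum_lessThan_telescope) (simp add: p0)
    also have "\<dots> = (\<Sum>i<N. simple_value S (p (Suc i)) \<omega> * (B (p (Suc i)) \<omega> - B (p i) \<omega>))"
    proof (intro sum.cong refl)
      fix i assume "i \<in> {..<N}"
      then have i: "i < N" by simp
      show "simple_integral S B (p (Suc i)) \<omega> - simple_integral S B (p i) \<omega> =
          simple_value S (p (Suc i)) \<omega> * (B (p (Suc i)) \<omega> - B (p i) \<omega>)"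
        by (rule simple_integral_step) (use br[OF i] S p[OF i] in blast)+
    qed
    finally show ?thesis .
  qed
  moreover have "(\<integral>\<^sup>+u\<in>{s<..t}. ennreal ((simple_value S u \<omega>)\<^sup>2) \<partial>lborel) =
      ennreal (\<Sum>i<N. (simple_value S (p (Suc i)) \<omega>)\<^sup>2 * (p (Suc i) - p i))" for \<omega>
    using nn_integral_simple_value[of N p S N \<omega>, OF p br] p0 by simp
  ultimately show ?thesis
    using lenglart_discrete[of p N "\<lambda>i. simple_value S (p (Suc i))" \<kappa> \<epsilon>, OF _ p m pos] st(1)
      less_imp_le[OF pos(1)] p0(1)
    by (simp only: ennreal_less_iff)
qed

end

subsection \<open>Local linearity of stochastic integrals\<close>

lemma (in prob_space) prob_tendsto_0:
  assumes A: "\<And>n. A n \<in> events"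
    and ev: "\<And>\<omega>. \<omega> \<in> space M \<Longrightarrow> \<forall>\<^sub>F n in sequentially. \<omega> \<notin> A n"
  shows "(\<lambda>n. prob (A n)) \<longlonglongrightarrow> 0"
proof -
  have "(\<lambda>n. expectation (indicator (A n) :: 'a \<Rightarrow> real)) \<longlonglongrightarrow> expectation (\<lambda>_. 0)"
  proof (rule integral_dominated_convergence[where w = "\<lambda>_. 1"])
    show "AE \<omega> in M. (\<lambda>n. indicator (A n) \<omega> :: real) \<longlonglongrightarrow> 0"
    proof (rule AE_I2)
      fix \<omega> assume "\<omega> \<in> space M"
      from ev[OF this] have "\<forall>\<^sub>F n in sequentially. (indicator (A n) \<omega> :: real) = 0"
        by eventually_elim simp
      then show "(\<lambda>n. indicator (A n) \<omega> :: real) \<longlonglongrightarrow> 0"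
        by (rule tendsto_eventually)
    qed
  qed (use A in auto)
  then show ?thesis using A by simp
qed

lemma power2_diff_le: "(x - z :: real)\<^sup>2 \<le> 2 * (x - y)\<^sup>2 + 2 * (y - z)\<^sup>2"
proof -
  have "0 \<le> ((x - y) - (y - z))\<^sup>2" by simp
  then show ?thesis by (simp add: power2_eq_square algebra_simps)
qed

lemma borel_measurable_simple_value_pair:
  assumes "\<And>a b \<xi>. (a, b, \<xi>) \<in> set S \<Longrightarrow> \<xi> \<in> borel_measurable M"
  shows "(\<lambda>(\<omega>, u). simple_value S u \<omega>) \<in> borel_measurable (M \<Otimes>\<^sub>M borel)"
  using assms
proof (induction S)
  case (Cons x S)
  obtain a b \<xi> where x: "x = (a, b, \<xi>)" by (cases x) auto
  have 1: "(\<lambda>(\<omega>, u). simple_value S u \<omega>) \<in> borel_measurable (M \<Otimes>\<^sub>M borel)"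
    by (rule Cons.IH) (meson Cons.prems list.set_intros(2))
  have [measurable]: "\<xi> \<in> borel_measurable M"
    by (rule Cons.prems[of a b]) (simp add: x)
  have 2: "(\<lambda>(\<omega>, u). \<xi> \<omega> * indicator {a<..b} u) \<in> borel_measurable (M \<Otimes>\<^sub>M borel)"
    by measurable
  have "(\<lambda>(\<omega>, u). simple_value (x # S) u \<omega>) =
      (\<lambda>z. (case z of (\<omega>, u) \<Rightarrow> \<xi> \<omega> * indicator {a<..b} u) + (case z of (\<omega>, u) \<Rightarrow> simple_value S u \<omega>))"
    by (auto simp: simple_value_def x)
  then show ?case using borel_measurable_add[OF 2 1] by (simp only:)
qed (simp add: simple_value_def)

context brownian
begin

text \<open>Progressive measurability is given on (0, t] with time as the first factor. Integrating
  out time calls for the factors in the other order and a function on the whole line, hence the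
  extension by zero.\<close>

lemma progressive_measurable_pair:
  fixes \<phi> :: "real \<Rightarrow> 'a \<Rightarrow> real"
  assumes "(\<lambda>(u, \<omega>). \<phi> u \<omega>) \<in> borel_measurable (restrict_space borel {0<..t} \<Otimes>\<^sub>M F t)" "0 < t"
  shows "(\<lambda>(\<omega>, u). if u \<in> {0<..t} then \<phi> u \<omega> else 0) \<in> borel_measurable (M \<Otimes>\<^sub>M borel)"
proof -
  \<comment> \<open>Times outside (0, t] are clamped to \<open>t\<close>, so that \<phi> is
    evaluated only where its measurability is known; the outer \<open>if\<close> discards these
    values.\<close>
  let ?c = "\<lambda>u. if u \<in> {0<..t} then u else t"
  have "?c \<in> measurable borel (restrict_space borel {0<..t})"
    using assms(2) by (intro measurable_restrict_space2) auto
  then have 1: "(\<lambda>z. ?c (snd z)) \<in> measurable (M \<Otimes>\<^sub>M borel) (restrict_space borel {0<..t})"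
    by (rule measurable_compose[OF measurable_snd])
  have "(\<lambda>\<omega>. \<omega>) \<in> measurable M (F t)"
    by (rule measurable_F[of _ t]) simp
  then have 2: "fst \<in> measurable (M \<Otimes>\<^sub>M borel) (F t)"
    using measurable_compose[OF measurable_fst, of "\<lambda>\<omega>. \<omega>" M "F t" borel] by simp
  have [measurable]: "(\<lambda>z. \<phi> (?c (snd z)) (fst z)) \<in> borel_measurable (M \<Otimes>\<^sub>M borel)"
    using measurable_compose[OF measurable_Pair[OF 1 2] assms(1)] by simp
  have "(\<lambda>z. if snd z \<in> {0<..t} then \<phi> (?c (snd z)) (fst z) else 0) \<in> borel_measurable (M \<Otimes>\<^sub>M borel)"
    by measurable
  also have "(\<lambda>z. if snd z \<in> {0<..t} then \<phi> (?c (snd z)) (fst z) else 0) =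
      (\<lambda>(\<omega>, u). if u \<in> {0<..t} then \<phi> u \<omega> else 0)"
    by (auto simp: fun_eq_iff)
  finally show ?thesis .
qed

text \<open>Under the integral \<phi> may be replaced by its zero extension, as (s, t] lies in (0,
  t]; integrating a jointly measurable function over time leaves a measurable function of
  \<omega>.\<close>

lemma measurable_square_integral:
  fixes g :: "real \<Rightarrow> 'a \<Rightarrow> real"
  assumes "(\<lambda>(u, \<omega>). \<phi> u \<omega>) \<in> borel_measurable (restrict_space borel {0<..t} \<Otimes>\<^sub>M F t)"
    and "(\<lambda>(\<omega>, u). g u \<omega>) \<in> borel_measurable (M \<Otimes>\<^sub>M borel)" and st: "0 \<le> s" "s < t"
  shows "(\<lambda>\<omega>. \<integral>\<^sup>+u\<in>{s<..t}. ennreal ((g u \<omega> - \<phi> u \<omega>)\<^sup>2) \<partial>lborel) \<in> borel_measurable M"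
proof -
  define \<psi> where "\<psi> = (\<lambda>u \<omega>. if u \<in> {0<..t} then \<phi> u \<omega> else 0)"
  have [measurable]: "(\<lambda>z. \<psi> (snd z) (fst z)) \<in> borel_measurable (M \<Otimes>\<^sub>M borel)"
    "(\<lambda>z. g (snd z) (fst z)) \<in> borel_measurable (M \<Otimes>\<^sub>M borel)"
    using progressive_measurable_pair[OF assms(1)] assms(2) st by (simp_all add: \<psi>_def split_beta')
  have "(\<lambda>z. ennreal ((g (snd z) (fst z) - \<psi> (snd z) (fst z))\<^sup>2) * indicator {s<..t} (snd z))
      \<in> borel_measurable (M \<Otimes>\<^sub>M borel)"
    by measurable
  then have "(\<lambda>(\<omega>, u). ennreal ((g u \<omega> - \<psi> u \<omega>)\<^sup>2) * indicator {s<..t} u)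
      \<in> borel_measurable (M \<Otimes>\<^sub>M lborel)"
    by (simp add: split_beta' cong: measurable_cong_sets)
  then have "(\<lambda>\<omega>. \<integral>\<^sup>+u. ennreal ((g u \<omega> - \<psi> u \<omega>)\<^sup>2) * indicator {s<..t} u \<partial>lborel) \<in> borel_measurable M"
    by (rule lborel.borel_measurable_nn_integral)
  also have "(\<lambda>\<omega>. \<integral>\<^sup>+u. ennreal ((g u \<omega> - \<psi> u \<omega>)\<^sup>2) * indicator {s<..t} u \<partial>lborel) =
      (\<lambda>\<omega>. \<integral>\<^sup>+u\<in>{s<..t}. ennreal ((g u \<omega> - \<phi> u \<omega>)\<^sup>2) \<partial>lborel)"
    using st by (intro ext nn_integral_cong) (auto simp: \<psi>_def indicator_def)
  finally show ?thesis .
qed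

lemma ito_integral_progressive:
  assumes "ito_integral M F B \<phi> J" "0 \<le> t"
  shows "(\<lambda>(u, \<omega>). \<phi> u \<omega>) \<in> borel_measurable (restrict_space borel {0<..t} \<Otimes>\<^sub>M F t)"
  using assms unfolding ito_integral_def by blast

lemma ito_integral_measurable:
  assumes "ito_integral M F B \<phi> J" "0 \<le> t"
  shows "J t \<in> borel_measurable M"
  using assms unfolding ito_integral_def by (blast intro: measurable_F)

text \<open>The error is the limit in probability of simple integrals of \<open>S n\<close> minus
  \<xi> over (s, t], and the tail bound for these passes to the limit. The factor 16 is 4/(1/2)^2:
  accumulated squares 4\<kappa> against the level \<epsilon>/2.\<close>

lemma ito_integral_increment_tail:
  assumes ito: "ito_integral M F B \<phi> J" and st: "0 \<le> s" "s < t"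
    and \<xi>: "\<xi> \<in> borel_measurable (F s)" and pos: "0 < \<kappa>" "0 < \<epsilon>"
  shows "prob {\<omega>\<in>space M. \<bar>J t \<omega> - J s \<omega> - \<xi> \<omega> * (B t \<omega> - B s \<omega>)\<bar> > \<epsilon>} \<le>
    prob {\<omega>\<in>space M. (\<integral>\<^sup>+u\<in>{s<..t}. ennreal ((\<xi> \<omega> - \<phi> u \<omega>)\<^sup>2) \<partial>lborel) > ennreal \<kappa>} + 16 * \<kappa> / \<epsilon>\<^sup>2"
proof -
  have prog: "(\<lambda>(u, \<omega>). \<phi> u \<omega>) \<in> borel_measurable (restrict_space borel {0<..t} \<Otimes>\<^sub>M F t)"
    using st by (intro ito_integral_progressive[OF ito]) auto
  have [measurable]: "J s \<in> borel_measurable M" "J t \<in> borel_measurable M"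
    using st ito_integral_measurable[OF ito] by auto
  have [measurable]: "\<xi> \<in> borel_measurable M" by (rule measurable_F[OF \<xi>])
  have [measurable]: "B s \<in> borel_measurable M" "B t \<in> borel_measurable M"
    using st by auto
  obtain S where S: "\<And>n. simple_integrand M F (S n)"
    and S1: "(\<lambda>n. prob {\<omega>\<in>space M.
              (\<integral>\<^sup>+u\<in>{0<..t}. ennreal ((simple_value (S n) u \<omega> - \<phi> u \<omega>)\<^sup>2) \<partial>lborel) > ennreal \<kappa>}) \<longlonglongrightarrow> 0"
    and S2: "\<And>u. 0 \<le> u \<Longrightarrow> (\<lambda>n. prob {\<omega>\<in>space M. \<bar>simple_integral (S n) B u \<omega> - J u \<omega>\<bar> > \<epsilon> / 4}) \<longlonglongrightarrow> 0"
  proof -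
    obtain S where "\<forall>n. simple_integrand M F (S n)"
      and "\<forall>T\<ge>0. \<forall>\<epsilon>>0. (\<lambda>n. prob {\<omega>\<in>space M.
              (\<integral>\<^sup>+u\<in>{0<..T}. ennreal ((simple_value (S n) u \<omega> - \<phi> u \<omega>)\<^sup>2) \<partial>lborel) > ennreal \<epsilon>}) \<longlonglongrightarrow> 0"
      and "\<forall>t\<ge>0. \<forall>\<epsilon>>0. (\<lambda>n. prob {\<omega>\<in>space M. \<bar>simple_integral (S n) B t \<omega> - J t \<omega>\<bar> > \<epsilon>}) \<longlonglongrightarrow> 0"
      using ito unfolding ito_integral_def by blast
    moreover have "0 \<le> t" "0 < \<epsilon> / 4" using st pos by auto
    ultimately show ?thesis using that[of S] pos(1) by blast
  qed
  have triple: "0 \<le> a \<and> a \<le> b \<and> \<eta> \<in> borel_measurable (F a)" if "(a, b, \<eta>) \<in> set (S n)" for n a b \<eta>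
    using S[of n] that by (auto simp: simple_integrand_def)
  let ?E = "\<lambda>u n. {\<omega>\<in>space M. \<bar>simple_integral (S n) B u \<omega> - J u \<omega>\<bar> > \<epsilon> / 4}"
  let ?D = "\<lambda>n. {\<omega>\<in>space M. (\<integral>\<^sup>+u\<in>{0<..t}. ennreal ((simple_value (S n) u \<omega> - \<phi> u \<omega>)\<^sup>2) \<partial>lborel) > ennreal \<kappa>}"
  let ?C = "{\<omega>\<in>space M. (\<integral>\<^sup>+u\<in>{s<..t}. ennreal ((\<xi> \<omega> - \<phi> u \<omega>)\<^sup>2) \<partial>lborel) > ennreal \<kappa>}"
  let ?L = "{\<omega>\<in>space M. \<bar>J t \<omega> - J s \<omega> - \<xi> \<omega> * (B t \<omega> - B s \<omega>)\<bar> > \<epsilon>}"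
  have main: "prob ?L \<le> (prob ?C + 16 * \<kappa> / \<epsilon>\<^sup>2) + (prob (?E s n) + prob (?E t n) + prob (?D n))" for n
  proof -
    \<comment> \<open>Subtracting \<xi> on (s, t] is one more triple in the list, so the error
      itself is approximated by a single simple integral.\<close>
    let ?S = "(s, t, \<lambda>\<omega>. - \<xi> \<omega>) # S n"
    have tS: "a \<le> b \<and> \<eta> \<in> borel_measurable (F a)" if "(a, b, \<eta>) \<in> set ?S" for a b \<eta>
      using that triple[of a b \<eta> n] st \<xi> by auto
    have tm: "\<eta> \<in> borel_measurable M" if "(a, b, \<eta>) \<in> set (S n)" for a b \<eta>
      using triple[OF that] measurable_F by blast
    have tb: "0 \<le> a \<and> 0 \<le> b" if "(a, b, \<eta>) \<in> set (S n)" for a b \<eta>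
      using triple[OF that] by auto
    have sI: "simple_integral (S n) B u \<in> borel_measurable M" if "0 \<le> u" for u
    proof -
      have "(\<lambda>\<omega>. simple_integral R B u \<omega>) \<in> borel_measurable M"
        if "\<And>a b \<eta>. (a, b, \<eta>) \<in> set R \<Longrightarrow> \<eta> \<in> borel_measurable M \<and> 0 \<le> a \<and> 0 \<le> b" for R
        using that
      proof (induction R)
        case (Cons x R)
        obtain a b \<eta> where x: "x = (a, b, \<eta>)" by (cases x) auto
        have ab: "\<eta> \<in> borel_measurable M \<and> 0 \<le> a \<and> 0 \<le> b"
          by (rule Cons.prems) (simp add: x)
        have [measurable]: "\<eta> \<in> borel_measurable M" "B (min b u) \<in> borel_measurable M"
          "B (min a u) \<in> borel_measurable M"
          using ab \<open>0 \<le> u\<close> by auto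
        have [measurable]: "(\<lambda>\<omega>. simple_integral R B u \<omega>) \<in> borel_measurable M"
          by (rule Cons.IH) (meson Cons.prems list.set_intros(2))
        have "(\<lambda>\<omega>. \<eta> \<omega> * (B (min b u) \<omega> - B (min a u) \<omega>) + simple_integral R B u \<omega>) \<in> borel_measurable M"
          by measurable
        then show ?case by (simp add: simple_integral_def x)
      qed (simp add: simple_integral_def[abs_def])
      from this[of "S n"] show ?thesis using tm tb by blast
    qed
    have t0: "0 \<le> t" using st by simp
    note [measurable] = sI[OF st(1)] sI[OF t0]
    have Em: "?E s n \<in> events" "?E t n \<in> events" by measurable
    have "(\<lambda>(\<omega>, u). simple_value (S n) u \<omega>) \<in> borel_measurable (M \<Otimes>\<^sub>M borel)"
      by (rule borel_measurable_simple_value_pair) (rule tm)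
    then have [measurable]: "(\<lambda>\<omega>. \<integral>\<^sup>+u\<in>{0<..t}. ennreal ((simple_value (S n) u \<omega> - \<phi> u \<omega>)\<^sup>2) \<partial>lborel) \<in> borel_measurable M"
      using st by (intro measurable_square_integral prog) auto
    have [measurable]: "(\<lambda>\<omega>. \<integral>\<^sup>+u\<in>{s<..t}. ennreal ((\<xi> \<omega> - \<phi> u \<omega>)\<^sup>2) \<partial>lborel) \<in> borel_measurable M"
      using st by (intro measurable_square_integral prog) auto
    have Cm: "?C \<in> events" and Dm: "?D n \<in> events" by measurable
    let ?I = "\<lambda>\<omega>. simple_integral ?S B t \<omega> - simple_integral ?S B s \<omega>"
    have I: "?I \<omega> = (simple_integral (S n) B t \<omega> - simple_integral (S n) B s \<omega>) - \<xi> \<omega> * (B t \<omega> - B s \<omega>)" for \<omega>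
      using st by (simp add: simple_integral_def min_def algebra_simps)
    let ?A = "{\<omega>\<in>space M. \<bar>?I \<omega>\<bar> > \<epsilon> / 2}"
    have Am: "?A \<in> events" unfolding I using st t0 by measurable
    let ?V = "{\<omega>\<in>space M. (\<integral>\<^sup>+u\<in>{s<..t}. ennreal ((simple_value ?S u \<omega>)\<^sup>2) \<partial>lborel) > ennreal (4 * \<kappa>)}"
    have A: "prob ?A \<le> prob ?V + 4 * \<kappa> / (\<epsilon> / 2)\<^sup>2"
      using pos by (intro simple_integral_tail tS st) auto
    \<comment> \<open>By (x - z)^2 \<le> 2(x - y)^2 + 2(y - z)^2 with \<phi> in the middle, two
      integrals of at most \<kappa> give at most 4\<kappa>.\<close>
    have V: "?V \<subseteq> ?C \<union> ?D n"
    proof (rule subsetI, rule ccontr)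
      fix \<omega> assume V: "\<omega> \<in> ?V" and n: "\<omega> \<notin> ?C \<union> ?D n"
      let ?f = "\<lambda>u. ennreal ((simple_value (S n) u \<omega> - \<phi> u \<omega>)\<^sup>2) * indicator {s<..t} u"
      let ?h = "\<lambda>u. ennreal ((\<xi> \<omega> - \<phi> u \<omega>)\<^sup>2) * indicator {s<..t} u"
      let ?\<psi> = "\<lambda>u. if u \<in> {0<..t} then \<phi> u \<omega> else 0"
      have \<omega>: "\<omega> \<in> space M" using V by auto
      have \<psi>m: "?\<psi> \<in> borel_measurable borel"
        using measurable_compose[OF measurable_Pair1'[OF \<omega>] progressive_measurable_pair[OF prog]] st by simp
      note [measurable] = \<psi>m borel_measurable_simple_value[of "S n" \<omega>]
      have "(\<lambda>u. ennreal ((simple_value (S n) u \<omega> - ?\<psi> u)\<^sup>2) * indicator {s<..t} u) \<in> borel_measurable lborel"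
        by measurable
      also have "(\<lambda>u. ennreal ((simple_value (S n) u \<omega> - ?\<psi> u)\<^sup>2) * indicator {s<..t} u) = ?f"
        using st by (auto simp: indicator_def fun_eq_iff)
      finally have fm: "?f \<in> borel_measurable lborel" .
      have "(\<lambda>u. ennreal ((\<xi> \<omega> - ?\<psi> u)\<^sup>2) * indicator {s<..t} u) \<in> borel_measurable lborel"
        by measurable
      also have "(\<lambda>u. ennreal ((\<xi> \<omega> - ?\<psi> u)\<^sup>2) * indicator {s<..t} u) = ?h"
        using st by (auto simp: indicator_def fun_eq_iff)
      finally have hm: "?h \<in> borel_measurable lborel" .
      have "ennreal ((simple_value ?S u \<omega>)\<^sup>2) * indicator {s<..t} u \<le> 2 * ?f u + 2 * ?h u" for u
      proof (cases "u \<in> {s<..t}")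
        case True
        then have "simple_value ?S u \<omega> = simple_value (S n) u \<omega> - \<xi> \<omega>"
          by (simp add: simple_value_def)
        moreover have "(simple_value (S n) u \<omega> - \<xi> \<omega>)\<^sup>2 \<le>
            2 * (simple_value (S n) u \<omega> - \<phi> u \<omega>)\<^sup>2 + 2 * (\<xi> \<omega> - \<phi> u \<omega>)\<^sup>2"
          using power2_diff_le[of "simple_value (S n) u \<omega>" "\<xi> \<omega>" "\<phi> u \<omega>"]
          by (simp add: power2_commute)
        ultimately have "ennreal ((simple_value ?S u \<omega>)\<^sup>2) \<le>
            ennreal (2 * (simple_value (S n) u \<omega> - \<phi> u \<omega>)\<^sup>2 + 2 * (\<xi> \<omega> - \<phi> u \<omega>)\<^sup>2)"
          by (simp only: ennreal_leI)
        also have "\<dots> = 2 * ennreal ((simple_value (S n) u \<omega> - \<phi> u \<omega>)\<^sup>2) + 2 * ennreal ((\<xi> \<omega> - \<phi> u \<omega>)\<^sup>2)"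
          by (simp add: ennreal_plus ennreal_mult)
        finally show ?thesis using True by simp
      qed simp
      then have "(\<integral>\<^sup>+u\<in>{s<..t}. ennreal ((simple_value ?S u \<omega>)\<^sup>2) \<partial>lborel) \<le>
          (\<integral>\<^sup>+u. 2 * ?f u + 2 * ?h u \<partial>lborel)"
        by (intro nn_integral_mono)
      also have "\<dots> = 2 * (\<integral>\<^sup>+u. ?f u \<partial>lborel) + 2 * (\<integral>\<^sup>+u. ?h u \<partial>lborel)"
        using fm hm by (subst nn_integral_add) (auto simp: nn_integral_cmult)
      also have "\<dots> \<le> 2 * ennreal \<kappa> + 2 * ennreal \<kappa>"
      proof (intro add_mono mult_left_mono)
        have "(\<integral>\<^sup>+u. ?f u \<partial>lborel) \<le>
            (\<integral>\<^sup>+u\<in>{0<..t}. ennreal ((simple_value (S n) u \<omega> - \<phi> u \<omega>)\<^sup>2) \<partial>lborel)"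
          using st by (intro nn_integral_mono) (auto simp: indicator_def)
        also have "\<dots> \<le> ennreal \<kappa>" using n \<omega> by auto
        finally show "(\<integral>\<^sup>+u. ?f u \<partial>lborel) \<le> ennreal \<kappa>" .
        show "(\<integral>\<^sup>+u. ?h u \<partial>lborel) \<le> ennreal \<kappa>" using n \<omega> by auto
      qed auto
      also have "\<dots> = ennreal (2 * \<kappa>) + ennreal (2 * \<kappa>)"
        using pos by (simp add: ennreal_mult)
      also have "\<dots> = ennreal (4 * \<kappa>)"
        using pos by (subst ennreal_plus[symmetric]) auto
      finally show False using V by auto
    qed
    have "prob ?V \<le> prob (?C \<union> ?D n)"
      using V Cm Dm by (intro finite_measure_mono) auto
    also have "\<dots> \<le> prob ?C + prob (?D n)" using Cm Dm by (intro measure_Un_le) auto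
    finally have PV: "prob ?V \<le> prob ?C + prob (?D n)" .
    \<comment> \<open>The level \<epsilon> is split into \<epsilon>/2 for the simple integral and
      \<epsilon>/4 for the approximation of \<open>J\<close> at each of the two ends.\<close>
    have "?L \<subseteq> ?A \<union> (?E s n \<union> ?E t n)"
    proof -
      have "\<epsilon> / 2 < \<bar>i' - i - x\<bar> \<or> \<epsilon> / 4 < \<bar>i - j\<bar> \<or> \<epsilon> / 4 < \<bar>i' - j'\<bar>"
        if "\<epsilon> < \<bar>j' - j - x\<bar>" for i i' j j' x
        using that by arith
      then show ?thesis unfolding I by blast
    qed
    then have "prob ?L \<le> prob (?A \<union> (?E s n \<union> ?E t n))"
      using Am Em by (intro finite_measure_mono) auto
    also have "\<dots> \<le> prob ?A + prob (?E s n \<union> ?E t n)" using Am Em by (intro measure_Un_le) auto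
    also have "\<dots> \<le> prob ?A + (prob (?E s n) + prob (?E t n))"
      using Em by (intro add_left_mono measure_Un_le) auto
    finally show ?thesis using A PV by (simp add: field_simps power2_eq_square)
  qed
  \<comment> \<open>The left side of \<open>main\<close> is free of \<open>n\<close>, while the
    approximation errors at \<open>s\<close>, at \<open>t\<close> and of the integrand vanish in the
    limit.\<close>
  have "(\<lambda>n. (prob ?C + 16 * \<kappa> / \<epsilon>\<^sup>2) + (prob (?E s n) + prob (?E t n) + prob (?D n))) \<longlonglongrightarrow>
      (prob ?C + 16 * \<kappa> / \<epsilon>\<^sup>2) + (0 + 0 + 0)"
    using st by (intro tendsto_intros S1 S2) auto
  then show ?thesis
    by (intro LIMSEQ_le_const[where X = "\<lambda>n. (prob ?C + 16 * \<kappa> / \<epsilon>\<^sup>2) + (prob (?E s n) + prob (?E t n) + prob (?D n))"])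
       (use main in auto)
qed

text \<open>Scaling: with the squares bounded by \<open>\<kappa> * v n\<close> and the level
  \<open>\<epsilon> * sqrt (v n)\<close>, the ratio in the tail bound does not depend on
  \<open>n\<close>. Continuity at \<open>s\<close> makes the squared deviation of \<phi> at most
  \<kappa> on short steps, for each path, so the exceptional event fades without any moment of
  \<phi>.\<close>

lemma ito_integral_local_linear:
  assumes ito: "ito_integral M F B \<phi> J" and s: "0 \<le> s"
    and \<xi>: "\<phi> s \<in> borel_measurable (F s)"
    and cont: "\<And>\<omega>. \<omega> \<in> space M \<Longrightarrow> continuous_on {0..} (\<lambda>u. \<phi> u \<omega>)"
    and v: "\<And>n. 0 < v n" "v \<longlonglongrightarrow> 0" and \<epsilon>: "0 < \<epsilon>"
  shows "(\<lambda>n. prob {\<omega>\<in>space M. \<bar>J (s + v n) \<omega> - J s \<omega> - \<phi> s \<omega> * (B (s + v n) \<omega> - B s \<omega>)\<bar> > \<epsilon> * sqrt (v n)})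
    \<longlonglongrightarrow> 0" (is "(\<lambda>n. prob (?L n)) \<longlonglongrightarrow> 0")
proof (rule LIMSEQ_I)
  fix e :: real assume e: "0 < e"
  \<comment> \<open>Chosen so that 16\<kappa>/\<epsilon>^2 = e/2; the other half of \<open>e\<close>
    goes to the exceptional event \<open>?C n\<close>.\<close>
  define \<kappa> where "\<kappa> = \<epsilon>\<^sup>2 * e / 32"
  have \<kappa>: "0 < \<kappa>" using \<epsilon> e by (simp add: \<kappa>_def)
  let ?C = "\<lambda>n. {\<omega>\<in>space M. (\<integral>\<^sup>+u\<in>{s<..s + v n}. ennreal ((\<phi> s \<omega> - \<phi> u \<omega>)\<^sup>2) \<partial>lborel) > ennreal (\<kappa> * v n)}"
  have le: "prob (?L n) \<le> prob (?C n) + e / 2" for n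
  proof -
    have "prob (?L n) \<le> prob (?C n) + 16 * (\<kappa> * v n) / (\<epsilon> * sqrt (v n))\<^sup>2"
      using s v \<xi> \<epsilon> \<kappa> by (intro ito_integral_increment_tail ito) auto
    also have "16 * (\<kappa> * v n) / (\<epsilon> * sqrt (v n))\<^sup>2 = e / 2"
      using v(1)[of n] \<epsilon> by (simp add: \<kappa>_def power_mult_distrib field_simps)
    finally show ?thesis .
  qed
  have "(\<lambda>n. prob (?C n)) \<longlonglongrightarrow> 0"
  proof (rule prob_tendsto_0)
    fix n
    have "(\<lambda>(u, \<omega>). \<phi> u \<omega>) \<in> borel_measurable (restrict_space borel {0<..s + v n} \<Otimes>\<^sub>M F (s + v n))"
      using s v(1)[of n] by (intro ito_integral_progressive[OF ito]) auto
    moreover have "(\<lambda>(\<omega>, u). \<phi> s \<omega>) \<in> borel_measurable (M \<Otimes>\<^sub>M borel)"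
      using measurable_F[OF \<xi>] by measurable
    ultimately have [measurable]: "(\<lambda>\<omega>. \<integral>\<^sup>+u\<in>{s<..s + v n}. ennreal ((\<phi> s \<omega> - \<phi> u \<omega>)\<^sup>2) \<partial>lborel) \<in> borel_measurable M"
      using s v(1)[of n] by (intro measurable_square_integral) auto
    show "?C n \<in> events" by measurable
  next
    fix \<omega> assume \<omega>: "\<omega> \<in> space M"
    have "\<exists>d>0. \<forall>u\<in>{0..}. dist u s < d \<longrightarrow> dist (\<phi> u \<omega>) (\<phi> s \<omega>) < sqrt \<kappa>"
      using cont[OF \<omega>] s \<kappa> unfolding continuous_on_iff by auto
    then obtain d where d: "d > 0" "\<And>u. 0 \<le> u \<Longrightarrow> dist u s < d \<Longrightarrow> dist (\<phi> u \<omega>) (\<phi> s \<omega>) < sqrt \<kappa>"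
      by auto
    have "\<forall>\<^sub>F n in sequentially. v n < d"
      using v(2) d(1) by (rule order_tendstoD)
    then show "\<forall>\<^sub>F n in sequentially. \<omega> \<notin> ?C n"
    proof eventually_elim
      case (elim n)
      have sq: "(\<phi> s \<omega> - \<phi> u \<omega>)\<^sup>2 \<le> \<kappa>" if "u \<in> {s<..s + v n}" for u
      proof -
        have "\<bar>\<phi> s \<omega> - \<phi> u \<omega>\<bar> \<le> sqrt \<kappa>"
          using d(2)[of u] that elim s by (auto simp: dist_real_def abs_minus_commute)
        from power_mono[OF this, of 2] \<kappa> show ?thesis by simp
      qed
      have "(\<integral>\<^sup>+u\<in>{s<..s + v n}. ennreal ((\<phi> s \<omega> - \<phi> u \<omega>)\<^sup>2) \<partial>lborel) \<le>
          (\<integral>\<^sup>+u. ennreal \<kappa> * indicator {s<..s + v n} u \<partial>lborel)"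
        by (rule nn_integral_mono) (auto simp: indicator_def intro!: ennreal_leI sq)
      also have "\<dots> = ennreal (\<kappa> * v n)"
        using v(1)[of n] \<kappa> by (simp add: nn_integral_cmult_indicator ennreal_mult)
      finally show ?case by (auto simp: not_less)
    qed
  qed
  then have "\<forall>\<^sub>F n in sequentially. prob (?C n) < e / 2"
    using e order_tendstoD(2)[of _ 0 sequentially "e / 2"] by simp
  then have "\<forall>\<^sub>F n in sequentially. prob (?L n) < e"
  proof eventually_elim
    case (elim n)
    then show ?case using le[of n] by linarith
  qed
  then show "\<exists>no. \<forall>n\<ge>no. norm (prob (?L n) - 0) < e"
    by (auto simp: eventually_sequentially)
qed

end

subsection \<open>Sums of squared increments\<close>

text \<open>The triangle inequality for the Euclidean norm, followed by comparison with the sum of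
  absolute values. It carries the termwise linearization error over to the root of the sum of
  squares, with no bound on the increments themselves.\<close>

lemma abs_L2_set_diff_le: "\<bar>L2_set f A - L2_set g A\<bar> \<le> (\<Sum>i\<in>A. \<bar>f i - g i\<bar>)"
proof -
  have "L2_set f A \<le> L2_set (\<lambda>i. f i - g i) A + L2_set g A" for f g :: "'a \<Rightarrow> real"
    using L2_set_triangle_ineq[of "\<lambda>i. f i - g i" g A] by simp
  from this[of f g] this[of g f]
  have "\<bar>L2_set f A - L2_set g A\<bar> \<le> L2_set (\<lambda>i. f i - g i) A"
    by (simp add: L2_set_def power2_commute[of "g _"])
  also have "\<dots> \<le> (\<Sum>i\<in>A. \<bar>f i - g i\<bar>)" by (rule L2_set_le_sum_abs)
  finally show ?thesis .
qed

section \<open>Tail bounds for sums of squares, for Brownian motion and for stochastic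
  integrals\<close>

context brownian
begin

text \<open>The summands D^2 - h are centred and independent of the past, so their second moments
  add up; each is 3h^2 - 2h^2 + h^2 = 2h^2.\<close>

lemma quadratic_variation_moments:
  fixes p :: "nat \<Rightarrow> real" and N :: nat
  defines "S \<equiv> \<lambda>k \<omega>. \<Sum>i<k. (B (p (Suc i)) \<omega> - B (p i) \<omega>)\<^sup>2 - (p (Suc i) - p i)"
  assumes p0: "0 \<le> p 0" and p: "\<And>i. i < N \<Longrightarrow> p i < p (Suc i)"
  shows "k \<le> N \<Longrightarrow> 0 \<le> p k \<and> S k \<in> borel_measurable (F (p k)) \<and> integrable M (\<lambda>\<omega>. (S k \<omega>)\<^sup>2) \<and>
    expectation (\<lambda>\<omega>. (S k \<omega>)\<^sup>2) = (\<Sum>i<k. 2 * (p (Suc i) - p i)\<^sup>2)"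
proof (induction k)
  case 0
  then show ?case using p0 by (simp add: S_def)
next
  case (Suc k)
  then have k: "k < N" by simp
  define h where "h = p (Suc k) - p k"
  define D where "D = (\<lambda>\<omega>. B (p (Suc k)) \<omega> - B (p k) \<omega>)"
  have pk: "0 \<le> p k" and pk': "p k < p (Suc k)" and Sm: "S k \<in> borel_measurable (F (p k))"
    and Si: "integrable M (\<lambda>\<omega>. (S k \<omega>)\<^sup>2)"
    and SE: "expectation (\<lambda>\<omega>. (S k \<omega>)\<^sup>2) = (\<Sum>i<k. 2 * (p (Suc i) - p i)\<^sup>2)"
    using Suc p by auto
  have Sint: "integrable M (S k)"
    using square_integrable_imp_integrable[OF measurable_F[OF Sm] Si] .
  have D2: "integrable M (\<lambda>\<omega>. (D \<omega>)\<^sup>2)" and D4: "integrable M (\<lambda>\<omega>. (D \<omega>) ^ 4)"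
    and E2: "expectation (\<lambda>\<omega>. (D \<omega>)\<^sup>2) = h" and E4: "expectation (\<lambda>\<omega>. (D \<omega>) ^ 4) = 3 * h\<^sup>2"
    unfolding D_def h_def
    using increment_integrable_power[OF pk pk'] increment_square[OF pk pk'] increment_fourth_moment[OF pk pk']
    by auto
  have i1: "integrable M (\<lambda>\<omega>. (D \<omega>)\<^sup>2 - h)" using D2 by simp
  have e1: "expectation (\<lambda>\<omega>. (D \<omega>)\<^sup>2 - h) = 0"
    using D2 E2 by (simp add: prob_space)
  note ind = increment_indep[OF pk pk' Sm Sint, of "\<lambda>x. x\<^sup>2 - h"]
  have i2: "integrable M (\<lambda>\<omega>. S k \<omega> * ((D \<omega>)\<^sup>2 - h))"
    and e2: "expectation (\<lambda>\<omega>. S k \<omega> * ((D \<omega>)\<^sup>2 - h)) = 0"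
    using ind i1 e1 by (simp_all add: D_def)
  have sq: "((D \<omega>)\<^sup>2 - h)\<^sup>2 = (D \<omega>) ^ 4 - 2 * h * (D \<omega>)\<^sup>2 + h\<^sup>2" for \<omega>
    by (simp add: power2_diff flip: power_mult)
  have i3: "integrable M (\<lambda>\<omega>. ((D \<omega>)\<^sup>2 - h)\<^sup>2)"
    unfolding sq using D2 D4 by simp
  have e3: "expectation (\<lambda>\<omega>. ((D \<omega>)\<^sup>2 - h)\<^sup>2) = 2 * h\<^sup>2"
    unfolding sq using D2 D4 E2 E4 by (simp add: prob_space power2_eq_square)
  have SS: "S (Suc k) = (\<lambda>\<omega>. S k \<omega> + ((D \<omega>)\<^sup>2 - h))"
    by (auto simp: S_def D_def h_def)
  have sq': "(S (Suc k) \<omega>)\<^sup>2 = (S k \<omega>)\<^sup>2 + (2 * (S k \<omega> * ((D \<omega>)\<^sup>2 - h)) + ((D \<omega>)\<^sup>2 - h)\<^sup>2)" for \<omega>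
    by (simp add: SS power2_sum)
  have [measurable]: "B (p (Suc k)) \<in> borel_measurable (F (p (Suc k)))"
    "B (p k) \<in> borel_measurable (F (p (Suc k)))" "S k \<in> borel_measurable (F (p (Suc k)))"
    using measurable_F_mono[OF less_imp_le[OF pk'] measurable_B[OF pk]] pk pk' measurable_B
      measurable_F_mono[OF less_imp_le[OF pk'] Sm] by auto
  have "S (Suc k) \<in> borel_measurable (F (p (Suc k)))"
    unfolding SS D_def by measurable
  moreover have "integrable M (\<lambda>\<omega>. (S (Suc k) \<omega>)\<^sup>2)"
    unfolding sq' using Si i2 i3 by simp
  moreover have "expectation (\<lambda>\<omega>. (S (Suc k) \<omega>)\<^sup>2) = (\<Sum>i<Suc k. 2 * (p (Suc i) - p i)\<^sup>2)"
    unfolding sq' using Si i2 i3 e2 e3 SE by (simp add: h_def)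
  ultimately show ?case using pk pk' by auto
qed

text \<open>Chebyshev's inequality at level \<eta>\<delta>: over \<open>n\<close> equal steps the
  variance is n times 2(\<delta>/n)^2, that is 2\<delta>^2/n. This decay is the reason for taking
  many increments.\<close>

lemma quadratic_variation_lower_tail:
  assumes s: "0 \<le> s" and \<delta>: "0 < \<delta>" and n: "0 < n" and \<eta>: "0 < \<eta>"
  defines "p \<equiv> \<lambda>k. s + real k * \<delta> / real n"
  shows "prob {\<omega>\<in>space M. (\<Sum>k<n. (B (p (Suc k)) \<omega> - B (p k) \<omega>)\<^sup>2) \<le> (1 - \<eta>) * \<delta>} \<le> 2 / (real n * \<eta>\<^sup>2)"
proof -
  have step: "p (Suc k) - p k = \<delta> / n" for k
    by (simp add: p_def distrib_right add_divide_distrib)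
  have p: "0 \<le> p 0" "p k < p (Suc k)" for k
    using s step[of k] divide_pos_pos[OF \<delta>, of "real n"] n by (simp add: p_def, linarith)
  let ?S = "\<lambda>\<omega>. \<Sum>k<n. (B (p (Suc k)) \<omega> - B (p k) \<omega>)\<^sup>2 - (p (Suc k) - p k)"
  have S: "?S \<omega> = (\<Sum>k<n. (B (p (Suc k)) \<omega> - B (p k) \<omega>)\<^sup>2) - \<delta>" for \<omega>
    using n by (simp add: step sum_subtractf)
  have q: "?S \<in> borel_measurable (F (p n))" "integrable M (\<lambda>\<omega>. (?S \<omega>)\<^sup>2)"
    "expectation (\<lambda>\<omega>. (?S \<omega>)\<^sup>2) = (\<Sum>i<n. 2 * (p (Suc i) - p i)\<^sup>2)"
    using quadratic_variation_moments[of p n n, OF p] by blast+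
  have "(\<Sum>i<n. 2 * (p (Suc i) - p i)\<^sup>2) = 2 * \<delta>\<^sup>2 / n"
    using n by (simp add: step power2_eq_square)
  then have "prob {\<omega>\<in>space M. \<bar>?S \<omega>\<bar> \<ge> \<eta> * \<delta>} \<le> (2 * \<delta>\<^sup>2 / n) / (\<eta> * \<delta>)\<^sup>2"
    using q \<eta> \<delta> by (intro prob_ge_le_second_moment measurable_F[OF q(1)]) auto
  also have "(2 * \<delta>\<^sup>2 / n) / (\<eta> * \<delta>)\<^sup>2 = 2 / (real n * \<eta>\<^sup>2)"
    using \<delta> by (simp add: power_mult_distrib)
  finally have *: "prob {\<omega>\<in>space M. \<bar>?S \<omega>\<bar> \<ge> \<eta> * \<delta>} \<le> 2 / (real n * \<eta>\<^sup>2)" .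
  have [measurable]: "?S \<in> borel_measurable M" by (rule measurable_F[OF q(1)])
  have "prob {\<omega>\<in>space M. (\<Sum>k<n. (B (p (Suc k)) \<omega> - B (p k) \<omega>)\<^sup>2) \<le> (1 - \<eta>) * \<delta>} \<le>
      prob {\<omega>\<in>space M. \<bar>?S \<omega>\<bar> \<ge> \<eta> * \<delta>}"
  proof (rule finite_measure_mono)
    show "{\<omega>\<in>space M. (\<Sum>k<n. (B (p (Suc k)) \<omega> - B (p k) \<omega>)\<^sup>2) \<le> (1 - \<eta>) * \<delta>} \<subseteq>
        {\<omega>\<in>space M. \<bar>?S \<omega>\<bar> \<ge> \<eta> * \<delta>}"
      unfolding S by (auto simp: algebra_simps)
  qed measurable
  with * show ?thesis by linarith
qed

text \<open>Markov's inequality sees only the mean, the telescoping total length. The number of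
  steps does not enter, and the steps may be unequal, as they are for the image of an equidistant
  grid under \<open>a\<close>.\<close>

lemma quadratic_variation_upper_tail:
  assumes p0: "0 \<le> p 0" and p: "\<And>i. i < n \<Longrightarrow> p i < p (Suc i)" and C: "0 < C"
  shows "prob {\<omega>\<in>space M. C \<le> (\<Sum>k<n. (B (p (Suc k)) \<omega> - B (p k) \<omega>)\<^sup>2)} \<le> (p n - p 0) / C"
proof -
  have pk: "0 \<le> p k" if "k \<le> n" for k
    using that
  proof (induction k)
    case (Suc k)
    then show ?case using p[of k] by auto
  qed (rule p0)
  have i: "integrable M (\<lambda>\<omega>. (B (p (Suc k)) \<omega> - B (p k) \<omega>)\<^sup>2)"
    and e: "expectation (\<lambda>\<omega>. (B (p (Suc k)) \<omega> - B (p k) \<omega>)\<^sup>2) = p (Suc k) - p k" if "k < n" for k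
    using increment_integrable_power[OF pk p] increment_square[OF pk p] that by auto
  have "prob {\<omega>\<in>space M. C \<le> (\<Sum>k<n. (B (p (Suc k)) \<omega> - B (p k) \<omega>)\<^sup>2)} \<le>
      expectation (\<lambda>\<omega>. \<Sum>k<n. (B (p (Suc k)) \<omega> - B (p k) \<omega>)\<^sup>2) / C"
    using C i by (intro integral_Markov_inequality_measure[where A = "{}"]) (auto intro!: AE_I2 sum_nonneg)
  also have "expectation (\<lambda>\<omega>. \<Sum>k<n. (B (p (Suc k)) \<omega> - B (p k) \<omega>)\<^sup>2) = (\<Sum>k<n. p (Suc k) - p k)"
    using i e by (subst Bochner_Integration.integral_sum) auto
  also have "\<dots> = p n - p 0" by (rule sum_lessThan_telescope)
  finally show ?thesis .
qed

text \<open>Every grid point is linearized from \<open>s\<close>, so an increment, being a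
  difference of two such values, carries two errors of order o(sqrt \<delta>). The threshold is
  proportional to the random value of \<phi> at \<open>s\<close>, so that this value can later be
  divided out; to compare with the errors it is bounded below off an event of small
  probability.\<close>

lemma ito_increments_L2_set:
  assumes ito: "ito_integral M F B \<phi> J" and s: "0 \<le> s"
    and \<phi>: "\<phi> s \<in> borel_measurable (F s)" and pos: "\<And>\<omega>. \<omega> \<in> space M \<Longrightarrow> 0 < \<phi> s \<omega>"
    and cont: "\<And>\<omega>. \<omega> \<in> space M \<Longrightarrow> continuous_on {0..} (\<lambda>u. \<phi> u \<omega>)"
    and \<tau>0: "\<And>j. \<tau> j 0 = 0" and \<tau>: "\<And>j k. 0 < k \<Longrightarrow> k \<le> n \<Longrightarrow> 0 < \<tau> j k \<and> \<tau> j k \<le> \<delta> j"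
    and \<delta>: "\<And>j. 0 < \<delta> j" "\<delta> \<longlonglongrightarrow> 0" and \<eta>: "0 < \<eta>"
  shows "(\<lambda>j. prob {\<omega>\<in>space M. \<eta> * \<phi> s \<omega> * sqrt (\<delta> j) \<le>
      \<bar>L2_set (\<lambda>k. J (s + \<tau> j (Suc k)) \<omega> - J (s + \<tau> j k) \<omega>) {..<n} -
       \<phi> s \<omega> * L2_set (\<lambda>k. B (s + \<tau> j (Suc k)) \<omega> - B (s + \<tau> j k) \<omega>) {..<n}\<bar>}) \<longlonglongrightarrow> 0"
    (is "(\<lambda>j. prob (?E j)) \<longlonglongrightarrow> 0")
proof (rule LIMSEQ_I)
  fix e :: real assume e: "0 < e"
  have [measurable]: "\<phi> s \<in> borel_measurable M" by (rule measurable_F[OF \<phi>])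
  \<comment> \<open>Positivity of \<phi> at \<open>s\<close> is not uniform in \<omega>; this yields
    a level \<open>m\<close> that it fails to exceed with probability less than e/2.\<close>
  have "(\<lambda>i. prob {\<omega>\<in>space M. \<phi> s \<omega> \<le> inverse (real (Suc i))}) \<longlonglongrightarrow> 0"
  proof (rule prob_tendsto_0)
    fix \<omega> assume "\<omega> \<in> space M"
    from order_tendstoD(2)[OF LIMSEQ_inverse_real_of_nat pos[OF this]]
    show "\<forall>\<^sub>F i in sequentially. \<omega> \<notin> {\<omega>\<in>space M. \<phi> s \<omega> \<le> inverse (real (Suc i))}"
      by eventually_elim auto
  qed measurable
  from order_tendstoD(2)[OF this, of "e / 2"] e
  obtain i where i: "prob {\<omega>\<in>space M. \<phi> s \<omega> \<le> inverse (real (Suc i))} < e / 2"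
    by (auto dest!: eventually_happens)
  define m where "m = inverse (real (Suc i))"
  have m: "0 < m" by (simp add: m_def)
  \<comment> \<open>Two errors per increment and \<open>n\<close> increments add up to n/(n+1) times
    \<eta> m sqrt(\<delta>); the \<open>Suc n\<close> keeps this strictly below the threshold and
    covers n = 0.\<close>
  define \<epsilon> where "\<epsilon> = \<eta> * m / (2 * real (Suc n))"
  have \<epsilon>: "0 < \<epsilon>" using \<eta> m by (simp add: \<epsilon>_def)
  let ?M = "{\<omega>\<in>space M. \<phi> s \<omega> \<le> m}"
  let ?R = "\<lambda>j k \<omega>. J (s + \<tau> j k) \<omega> - J s \<omega> - \<phi> s \<omega> * (B (s + \<tau> j k) \<omega> - B s \<omega>)"
  let ?L = "\<lambda>j k. {\<omega>\<in>space M. \<bar>?R j k \<omega>\<bar> > \<epsilon> * sqrt (\<tau> j k)}"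
  have [measurable]: "J (s + \<tau> j k) \<in> borel_measurable M" "B (s + \<tau> j k) \<in> borel_measurable M"
    if "k \<le> n" for j k
    using ito_integral_measurable[OF ito, of "s + \<tau> j k"] measurable_B'[of "s + \<tau> j k"] s \<tau>[of k j] \<tau>0[of j] that
    by (cases "k = 0"; simp)+
  have [measurable]: "J s \<in> borel_measurable M" "B s \<in> borel_measurable M"
    using ito_integral_measurable[OF ito s] measurable_B'[OF s] by auto
  have Lm: "?L j k \<in> events" if "k \<in> {1..n}" for j k
    using that by auto
  have sub: "?E j \<subseteq> ?M \<union> (\<Union>k\<in>{1..n}. ?L j k)" for j
  proof (rule subsetI, rule ccontr)
    fix \<omega> assume E: "\<omega> \<in> ?E j" and not: "\<omega> \<notin> ?M \<union> (\<Union>k\<in>{1..n}. ?L j k)"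
    have \<omega>: "\<omega> \<in> space M" "m < \<phi> s \<omega>" using E not by auto
    have R: "\<bar>?R j k \<omega>\<bar> \<le> \<epsilon> * sqrt (\<delta> j)" if "k \<le> n" for k
    proof (cases "k = 0")
      case True
      then show ?thesis using \<epsilon> \<delta>(1)[of j] by (simp add: \<tau>0)
    next
      case False
      then have "k \<in> {1..n}" using that by auto
      then have "\<bar>?R j k \<omega>\<bar> \<le> \<epsilon> * sqrt (\<tau> j k)" using not \<omega> not_less by blast
      also have "\<dots> \<le> \<epsilon> * sqrt (\<delta> j)" using \<tau>[of k j] False that \<epsilon> by simp
      finally show ?thesis .
    qed
    have "\<bar>L2_set (\<lambda>k. J (s + \<tau> j (Suc k)) \<omega> - J (s + \<tau> j k) \<omega>) {..<n} -
       \<phi> s \<omega> * L2_set (\<lambda>k. B (s + \<tau> j (Suc k)) \<omega> - B (s + \<tau> j k) \<omega>) {..<n}\<bar> \<le>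
       (\<Sum>k<n. \<bar>(J (s + \<tau> j (Suc k)) \<omega> - J (s + \<tau> j k) \<omega>) - \<phi> s \<omega> * (B (s + \<tau> j (Suc k)) \<omega> - B (s + \<tau> j k) \<omega>)\<bar>)"
      using pos[OF \<omega>(1)] by (subst L2_set_right_distrib) (auto intro: abs_L2_set_diff_le)
    also have "\<dots> \<le> (\<Sum>k<n. 2 * (\<epsilon> * sqrt (\<delta> j)))"
    proof (rule sum_mono)
      fix k assume "k \<in> {..<n}"
      then have "\<bar>?R j (Suc k) \<omega>\<bar> \<le> \<epsilon> * sqrt (\<delta> j)" "\<bar>?R j k \<omega>\<bar> \<le> \<epsilon> * sqrt (\<delta> j)"
        by (intro R; simp)+
      moreover have "(J (s + \<tau> j (Suc k)) \<omega> - J (s + \<tau> j k) \<omega>) - \<phi> s \<omega> * (B (s + \<tau> j (Suc k)) \<omega> - B (s + \<tau> j k) \<omega>) =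
          ?R j (Suc k) \<omega> - ?R j k \<omega>"
        by (simp add: algebra_simps)
      ultimately show "\<bar>(J (s + \<tau> j (Suc k)) \<omega> - J (s + \<tau> j k) \<omega>) -
          \<phi> s \<omega> * (B (s + \<tau> j (Suc k)) \<omega> - B (s + \<tau> j k) \<omega>)\<bar> \<le> 2 * (\<epsilon> * sqrt (\<delta> j))"
        by linarith
    qed
    also have "\<dots> = real n / real (Suc n) * (\<eta> * m * sqrt (\<delta> j))"
      by (simp add: \<epsilon>_def field_simps)
    also have "\<dots> < 1 * (\<eta> * m * sqrt (\<delta> j))"
      using \<eta> m \<delta>(1)[of j] by (intro mult_strict_right_mono) auto
    also have "\<dots> < \<eta> * \<phi> s \<omega> * sqrt (\<delta> j)"
      using \<eta> \<omega> \<delta>(1)[of j] by simp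
    finally show False using E by auto
  qed
  have le: "prob (?E j) \<le> prob ?M + (\<Sum>k\<in>{1..n}. prob (?L j k))" for j
  proof -
    have "prob (?E j) \<le> prob (?M \<union> (\<Union>k\<in>{1..n}. ?L j k))"
      using Lm by (intro finite_measure_mono sub sets.Un sets.finite_UN) auto
    also have "\<dots> \<le> prob ?M + prob (\<Union>k\<in>{1..n}. ?L j k)"
      using Lm by (intro measure_Un_le sets.finite_UN) auto
    also have "\<dots> \<le> prob ?M + (\<Sum>k\<in>{1..n}. prob (?L j k))"
      using Lm by (intro add_left_mono measure_UNION_le) auto
    finally show ?thesis .
  qed
  \<comment> \<open>The number of grid points stays fixed as \<open>j\<close> grows, so finitely
    many null sequences are added.\<close>
  have "(\<lambda>j. \<Sum>k\<in>{1..n}. prob (?L j k)) \<longlonglongrightarrow> (\<Sum>k\<in>{1..n}. 0)"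
  proof (rule tendsto_sum)
    fix k assume k: "k \<in> {1..n}"
    have "(\<lambda>j. \<tau> j k) \<longlonglongrightarrow> 0"
      using \<tau>[of k] k by (intro tendsto_sandwich[OF _ _ tendsto_const \<delta>(2)] always_eventually) (auto simp: less_imp_le)
    then show "(\<lambda>j. prob (?L j k)) \<longlonglongrightarrow> 0"
      using \<tau>[of k] k by (intro ito_integral_local_linear ito s \<phi> cont \<epsilon>) auto
  qed
  then have "(\<lambda>j. \<Sum>k\<in>{1..n}. prob (?L j k)) \<longlonglongrightarrow> 0" by simp
  then have "\<forall>\<^sub>F j in sequentially. (\<Sum>k\<in>{1..n}. prob (?L j k)) < e / 2"
    by (rule order_tendstoD(2)) (use e in simp)
  then have "\<forall>\<^sub>F j in sequentially. prob (?E j) < e"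
  proof eventually_elim
    case (elim j)
    then show ?case using le[of j] i unfolding m_def by linarith
  qed
  then show "\<exists>no. \<forall>j\<ge>no. norm (prob (?E j) - 0) < e"
    by (auto simp: eventually_sequentially)
qed

text \<open>Half of \<eta> absorbs the linearization error; the other half is left for the Brownian
  sum of squares, whence 2/(n(\<eta>/2)^2) = 8/(n\<eta>^2). The inequality (1 - \<eta>/2)^2 \<le> 1
  - \<eta>/2 leads back from roots to squares.\<close>

lemma ito_increments_lower:
  assumes ito: "ito_integral M F B \<phi> J" and s: "0 \<le> s"
    and \<phi>: "\<phi> s \<in> borel_measurable (F s)" and pos: "\<And>\<omega>. \<omega> \<in> space M \<Longrightarrow> 0 < \<phi> s \<omega>"
    and cont: "\<And>\<omega>. \<omega> \<in> space M \<Longrightarrow> continuous_on {0..} (\<lambda>u. \<phi> u \<omega>)"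
    and \<delta>: "\<And>j. 0 < \<delta> j" "\<delta> \<longlonglongrightarrow> 0" and n: "0 < n" and \<eta>: "0 < \<eta>" "\<eta> < 1" and e: "0 < e"
  defines "p \<equiv> \<lambda>j k. s + real k * \<delta> j / real n"
  shows "\<forall>\<^sub>F j in sequentially. prob {\<omega>\<in>space M.
      L2_set (\<lambda>k. J (p j (Suc k)) \<omega> - J (p j k) \<omega>) {..<n} < (1 - \<eta>) * \<phi> s \<omega> * sqrt (\<delta> j)} <
      8 / (real n * \<eta>\<^sup>2) + e"
proof -
  let ?J = "\<lambda>j \<omega>. L2_set (\<lambda>k. J (p j (Suc k)) \<omega> - J (p j k) \<omega>) {..<n}"
  let ?B = "\<lambda>j \<omega>. L2_set (\<lambda>k. B (p j (Suc k)) \<omega> - B (p j k) \<omega>) {..<n}"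
  let ?bad = "\<lambda>j. {\<omega>\<in>space M. \<eta> / 2 * \<phi> s \<omega> * sqrt (\<delta> j) \<le> \<bar>?J j \<omega> - \<phi> s \<omega> * ?B j \<omega>\<bar>}"
  let ?Q = "\<lambda>j. {\<omega>\<in>space M. (\<Sum>k<n. (B (p j (Suc k)) \<omega> - B (p j k) \<omega>)\<^sup>2) \<le> (1 - \<eta> / 2) * \<delta> j}"
  let ?E = "\<lambda>j. {\<omega>\<in>space M. ?J j \<omega> < (1 - \<eta>) * \<phi> s \<omega> * sqrt (\<delta> j)}"
  have "(\<lambda>j. prob (?bad j)) \<longlonglongrightarrow> 0"
    unfolding p_def using \<delta> n \<eta>
    by (intro ito_increments_L2_set[OF ito s \<phi> pos cont])
       (auto simp: mult_le_cancel_right1 divide_le_eq intro!: divide_pos_pos mult_pos_pos)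
  then have "\<forall>\<^sub>F j in sequentially. prob (?bad j) < e"
    using e by (rule order_tendstoD)
  then show ?thesis
  proof eventually_elim
    case (elim j)
    have p0: "0 \<le> p j k" for k
      using s \<delta>(1)[of j] by (auto simp: p_def intro!: add_nonneg_nonneg divide_nonneg_nonneg)
    have [measurable]: "J (p j k) \<in> borel_measurable M" "B (p j k) \<in> borel_measurable M"
      "\<phi> s \<in> borel_measurable M" for k
      using ito_integral_measurable[OF ito p0] measurable_B'[OF p0] measurable_F[OF \<phi>] by auto
    have sub: "?E j \<subseteq> ?bad j \<union> ?Q j"
    proof (rule subsetI, rule ccontr)
      fix \<omega> assume E: "\<omega> \<in> ?E j" and not: "\<omega> \<notin> ?bad j \<union> ?Q j"
      have \<omega>: "\<omega> \<in> space M" using E by auto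
      have "\<phi> s \<omega> * ?B j \<omega> < (1 - \<eta>) * \<phi> s \<omega> * sqrt (\<delta> j) + \<eta> / 2 * \<phi> s \<omega> * sqrt (\<delta> j)"
      proof -
        have "\<bar>?J j \<omega> - \<phi> s \<omega> * ?B j \<omega>\<bar> < \<eta> / 2 * \<phi> s \<omega> * sqrt (\<delta> j)"
          using not \<omega> not_le by blast
        moreover have "?J j \<omega> < (1 - \<eta>) * \<phi> s \<omega> * sqrt (\<delta> j)" using E by auto
        ultimately show ?thesis by linarith
      qed
      also have "\<dots> = \<phi> s \<omega> * ((1 - \<eta> / 2) * sqrt (\<delta> j))"
        by (simp add: algebra_simps)
      finally have "?B j \<omega> < (1 - \<eta> / 2) * sqrt (\<delta> j)"
        using pos[OF \<omega>] by simp
      then have "(?B j \<omega>)\<^sup>2 \<le> ((1 - \<eta> / 2) * sqrt (\<delta> j))\<^sup>2"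
        by (intro power_mono) (auto simp: L2_set_nonneg)
      also have "\<dots> = (1 - \<eta> / 2)\<^sup>2 * \<delta> j"
        using \<delta>(1)[of j] by (simp add: power_mult_distrib)
      also have "\<dots> \<le> (1 - \<eta> / 2) * \<delta> j"
        using \<delta>(1)[of j] \<eta> by (intro mult_right_mono) (auto simp: power2_eq_square mult_left_le)
      finally have "(\<Sum>k<n. (B (p j (Suc k)) \<omega> - B (p j k) \<omega>)\<^sup>2) \<le> (1 - \<eta> / 2) * \<delta> j"
        by (simp add: L2_set_def sum_nonneg)
      with not \<omega> show False by auto
    qed
    have "prob (?E j) \<le> prob (?bad j \<union> ?Q j)"
      unfolding L2_set_def
      by (rule finite_measure_mono[OF sub[unfolded L2_set_def]]) measurable
    also have "\<dots> \<le> prob (?bad j) + prob (?Q j)"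
      unfolding L2_set_def by (rule measure_Un_le) measurable
    also have "prob (?Q j) \<le> 2 / (real n * (\<eta> / 2)\<^sup>2)"
      unfolding p_def using s \<delta>(1) n \<eta> by (intro quadratic_variation_lower_tail) auto
    also have "2 / (real n * (\<eta> / 2)\<^sup>2) = 8 / (real n * \<eta>\<^sup>2)"
      by (simp add: power_divide)
    finally show ?case using elim by linarith
  qed
qed

text \<open>The grid has length at most \<open>q * \<delta> j\<close> but is measured against
  \<open>\<delta> j\<close>, so Markov's inequality leaves the ratio \<open>q\<close>. Linearization
  costs a second \<eta>, and (1 - 2\<eta>)^2 \<ge> 1 - 4\<eta> produces the denominator.\<close>

lemma ito_increments_upper:
  assumes ito: "ito_integral M F B \<phi> J" and s: "0 \<le> s"
    and \<phi>: "\<phi> s \<in> borel_measurable (F s)" and pos: "\<And>\<omega>. \<omega> \<in> space M \<Longrightarrow> 0 < \<phi> s \<omega>"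
    and cont: "\<And>\<omega>. \<omega> \<in> space M \<Longrightarrow> continuous_on {0..} (\<lambda>u. \<phi> u \<omega>)"
    and \<tau>0: "\<And>j. \<tau> j 0 = 0" and \<tau>: "\<And>j k. \<tau> j k < \<tau> j (Suc k)" and q: "\<And>j. \<tau> j n \<le> q * \<delta> j" "q \<le> 1"
    and \<delta>: "\<And>j. 0 < \<delta> j" "\<delta> \<longlonglongrightarrow> 0" and \<eta>: "0 < \<eta>" "4 * \<eta> < 1" and e: "0 < e"
  shows "\<forall>\<^sub>F j in sequentially. prob {\<omega>\<in>space M.
      (1 - \<eta>) * \<phi> s \<omega> * sqrt (\<delta> j) \<le> L2_set (\<lambda>k. J (s + \<tau> j (Suc k)) \<omega> - J (s + \<tau> j k) \<omega>) {..<n}} <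
      q / (1 - 4 * \<eta>) + e"
proof -
  let ?J = "\<lambda>j \<omega>. L2_set (\<lambda>k. J (s + \<tau> j (Suc k)) \<omega> - J (s + \<tau> j k) \<omega>) {..<n}"
  let ?B = "\<lambda>j \<omega>. L2_set (\<lambda>k. B (s + \<tau> j (Suc k)) \<omega> - B (s + \<tau> j k) \<omega>) {..<n}"
  let ?bad = "\<lambda>j. {\<omega>\<in>space M. \<eta> * \<phi> s \<omega> * sqrt (\<delta> j) \<le> \<bar>?J j \<omega> - \<phi> s \<omega> * ?B j \<omega>\<bar>}"
  let ?Q = "\<lambda>j. {\<omega>\<in>space M. (1 - 4 * \<eta>) * \<delta> j \<le> (\<Sum>k<n. (B (s + \<tau> j (Suc k)) \<omega> - B (s + \<tau> j k) \<omega>)\<^sup>2)}"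
  let ?E = "\<lambda>j. {\<omega>\<in>space M. (1 - \<eta>) * \<phi> s \<omega> * sqrt (\<delta> j) \<le> ?J j \<omega>}"
  have mono: "strict_mono (\<tau> j)" for j
    using \<tau> by (simp add: strict_mono_Suc_iff)
  have \<tau>n: "0 < \<tau> j k \<and> \<tau> j k \<le> \<delta> j" if "0 < k" "k \<le> n" for j k
  proof -
    have "\<tau> j 0 < \<tau> j k" using mono that(1) by (simp add: strict_mono_def)
    moreover have "\<tau> j k \<le> \<tau> j n" using mono that(2) by (simp add: strict_mono_leD)
    moreover have "q * \<delta> j \<le> \<delta> j" using q(2) \<delta>(1)[of j] by (simp add: mult_le_cancel_right1)
    ultimately show ?thesis using q(1)[of j] \<tau>0[of j] by linarith
  qed
  have "(\<lambda>j. prob (?bad j)) \<longlonglongrightarrow> 0"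
    by (rule ito_increments_L2_set[where \<phi> = \<phi> and \<tau> = \<tau>, OF ito s \<phi> pos cont \<tau>0 \<tau>n \<delta> \<eta>(1)])
  then have "\<forall>\<^sub>F j in sequentially. prob (?bad j) < e"
    using e by (rule order_tendstoD)
  then show ?thesis
  proof eventually_elim
    case (elim j)
    have p0: "0 \<le> s + \<tau> j k" for k
      using s \<tau>0[of j] strict_mono_leD[OF mono[of j], of 0 k] by simp
    have [measurable]: "J (s + \<tau> j k) \<in> borel_measurable M" "B (s + \<tau> j k) \<in> borel_measurable M"
      "\<phi> s \<in> borel_measurable M" for k
      using ito_integral_measurable[OF ito p0] measurable_B'[OF p0] measurable_F[OF \<phi>] by auto
    have sub: "?E j \<subseteq> ?bad j \<union> ?Q j"
    proof (rule subsetI, rule ccontr)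
      fix \<omega> assume E: "\<omega> \<in> ?E j" and not: "\<omega> \<notin> ?bad j \<union> ?Q j"
      have \<omega>: "\<omega> \<in> space M" using E by auto
      have "\<phi> s \<omega> * ((1 - 2 * \<eta>) * sqrt (\<delta> j)) =
          (1 - \<eta>) * \<phi> s \<omega> * sqrt (\<delta> j) - \<eta> * \<phi> s \<omega> * sqrt (\<delta> j)"
        by (simp add: algebra_simps)
      also have "\<dots> < \<phi> s \<omega> * ?B j \<omega>"
      proof -
        have "\<bar>?J j \<omega> - \<phi> s \<omega> * ?B j \<omega>\<bar> < \<eta> * \<phi> s \<omega> * sqrt (\<delta> j)"
          using not \<omega> not_le by blast
        moreover have "(1 - \<eta>) * \<phi> s \<omega> * sqrt (\<delta> j) \<le> ?J j \<omega>" using E by auto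
        ultimately show ?thesis by linarith
      qed
      finally have "(1 - 2 * \<eta>) * sqrt (\<delta> j) < ?B j \<omega>"
        using pos[OF \<omega>] by simp
      then have "((1 - 2 * \<eta>) * sqrt (\<delta> j))\<^sup>2 \<le> (?B j \<omega>)\<^sup>2"
        using \<eta> \<delta>(1)[of j] by (intro power_mono) auto
      moreover have "((1 - 2 * \<eta>) * sqrt (\<delta> j))\<^sup>2 = (1 - 2 * \<eta>)\<^sup>2 * \<delta> j"
        using \<delta>(1)[of j] by (simp add: power_mult_distrib)
      moreover have "(1 - 4 * \<eta>) * \<delta> j \<le> (1 - 2 * \<eta>)\<^sup>2 * \<delta> j"
        using \<delta>(1)[of j] by (intro mult_right_mono) (auto simp: power2_diff)
      ultimately have "(1 - 4 * \<eta>) * \<delta> j \<le> (\<Sum>k<n. (B (s + \<tau> j (Suc k)) \<omega> - B (s + \<tau> j k) \<omega>)\<^sup>2)"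
        by (simp add: L2_set_def sum_nonneg)
      with not \<omega> show False by auto
    qed
    have "prob (?E j) \<le> prob (?bad j \<union> ?Q j)"
      unfolding L2_set_def
      by (rule finite_measure_mono[OF sub[unfolded L2_set_def]]) measurable
    also have "\<dots> \<le> prob (?bad j) + prob (?Q j)"
      unfolding L2_set_def by (rule measure_Un_le) measurable
    also have "prob (?Q j) \<le> ((s + \<tau> j n) - (s + \<tau> j 0)) / ((1 - 4 * \<eta>) * \<delta> j)"
      using p0 \<tau> \<eta> \<delta>(1)[of j] by (intro quadratic_variation_upper_tail) auto
    also have "\<dots> \<le> (q * \<delta> j) / ((1 - 4 * \<eta>) * \<delta> j)"
      using q(1)[of j] \<tau>0[of j] \<eta> \<delta>(1)[of j] by (intro divide_right_mono) auto
    also have "\<dots> = q / (1 - 4 * \<eta>)" using \<delta>(1)[of j] by simp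
    finally show ?case using elim by linarith
  qed
qed

end

subsection \<open>Mixing two processes by an independent Bernoulli variable\<close>

text \<open>Events of the time-changed path up to \<open>s\<close> belong to \<open>F (a s)\<close>,
  where the martingale property between \<open>a s\<close> and \<open>a t\<close> applies. The
  conclusion mentions no filtration, so \<open>G\<close> and \<open>H\<close> can be treated alike;
  for \<open>H\<close> the time change is the identity.\<close>

lemma (in prob_space) martingale_time_change:
  fixes a :: "real \<Rightarrow> real"
  assumes X: "martingale M F X" and a: "\<And>u v. 0 \<le> u \<Longrightarrow> u \<le> v \<Longrightarrow> 0 \<le> a u \<and> a u \<le> a v"
    and st: "0 \<le> s" "s \<le> t" and C: "C \<in> sets (\<Pi>\<^sub>M u\<in>{0..s}. borel)"
  shows "expectation (\<lambda>\<omega>. indicator C (\<lambda>u\<in>{0..s}. X (a u) \<omega>) * X (a t) \<omega>) =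
    expectation (\<lambda>\<omega>. indicator C (\<lambda>u\<in>{0..s}. X (a u) \<omega>) * X (a s) \<omega>)"
proof -
  have fil: "filtration (space M) F" "\<And>u. subalgebra M (F u)"
    and m: "\<And>u. 0 \<le> u \<Longrightarrow> X u \<in> borel_measurable (F u)" "\<And>u. 0 \<le> u \<Longrightarrow> integrable M (X u)"
    and ce: "AE \<omega> in M. real_cond_exp M (F (a s)) (X (a t)) \<omega> = X (a s) \<omega>"
    using X a[of 0 s] a[of s t] st by (auto simp: martingale_def filtration_on_def)
  interpret S: sigma_finite_subalgebra M "F (a s)"
    by (intro finite_measure_subalgebra_is_sigma_finite finite_measure_subalgebra.intro
        finite_measure_subalgebra_axioms.intro fil finite_measure_axioms)
  have sp: "space (F u) = space M" for u using fil(2) by (auto simp: subalgebra_def)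
  have "X (a u) \<in> borel_measurable (F (a s))" if "u \<in> {0..s}" for u
    using m(1)[of "a u"] a[of u u] a[of u s] that filtration.sets_F_mono[OF fil(1), of "a u" "a s"]
    by (auto simp: measurable_def sp)
  then have path: "(\<lambda>\<omega>. \<lambda>u\<in>{0..s}. X (a u) \<omega>) \<in> measurable (F (a s)) (\<Pi>\<^sub>M u\<in>{0..s}. borel)"
    by (intro measurable_restrict)
  define A where "A = (\<lambda>\<omega>. \<lambda>u\<in>{0..s}. X (a u) \<omega>) -` C \<inter> space M"
  have A: "A \<in> sets (F (a s))"
    using measurable_sets[OF path C] by (simp add: A_def sp)
  have ind: "expectation (\<lambda>\<omega>. indicator C (\<lambda>u\<in>{0..s}. X (a u) \<omega>) * Y \<omega>) = (\<integral>\<omega>\<in>A. Y \<omega> \<partial>M)"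
    for Y :: "'a \<Rightarrow> real"
    unfolding set_lebesgue_integral_def
    by (intro Bochner_Integration.integral_cong) (auto simp: A_def indicator_def)
  have "A \<in> sets M" using A fil(2)[of "a s"] by (auto simp: subalgebra_def)
  have a0: "0 \<le> a u" if "0 \<le> u" for u using a[of u u] that by simp
  have st': "0 \<le> a s" "0 \<le> a t" using st by (auto intro: a0)
  have "(\<integral>\<omega>\<in>A. X (a t) \<omega> \<partial>M) = (\<integral>\<omega>\<in>A. real_cond_exp M (F (a s)) (X (a t)) \<omega> \<partial>M)"
    using st' by (intro S.real_cond_exp_intA m A)
  also have "\<dots> = (\<integral>\<omega>\<in>A. X (a s) \<omega> \<partial>M)"
    unfolding set_lebesgue_integral_def
    using ce \<open>A \<in> sets M\<close> borel_measurable_integrable[OF m(2)[OF st'(1)]]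
    by (intro integral_cong_AE) auto
  finally show ?thesis by (simp add: ind)
qed

locale mixture = prob_space M for M :: "'a measure" +
  fixes Z :: "'a \<Rightarrow> nat" and c :: real and G H :: "real \<Rightarrow> 'a \<Rightarrow> real"
  assumes Z [measurable]: "Z \<in> measurable M (count_space UNIV)"
    and Z01: "\<And>\<omega>. \<omega> \<in> space M \<Longrightarrow> Z \<omega> \<in> {0, 1}" and Zc: "prob {\<omega>\<in>space M. Z \<omega> = 1} = c"
    and indep: "indep_set (sets (vimage_algebra (space M) Z (count_space UNIV)))
      (sets (vimage_algebra (space M) (\<lambda>\<omega>. (path_of G \<omega>, path_of H \<omega>)) (path_space \<Otimes>\<^sub>M path_space)))"
begin

definition paths :: "'a measure" where
  "paths = vimage_algebra (space M) (\<lambda>\<omega>. (path_of G \<omega>, path_of H \<omega>)) (path_space \<Otimes>\<^sub>M path_space)"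

definition mix :: "real \<Rightarrow> 'a \<Rightarrow> real" where
  "mix = (\<lambda>t \<omega>. G t \<omega> * indicator {\<omega>. Z \<omega> = 1} \<omega> + H t \<omega> * indicator {\<omega>. Z \<omega> = 0} \<omega>)"

lemma mix_eq: "\<omega> \<in> space M \<Longrightarrow> mix t \<omega> = (if Z \<omega> = 1 then G t \<omega> else H t \<omega>)"
  using Z01[of \<omega>] by (auto simp: mix_def)

lemma subalgebra_paths: "subalgebra M paths"
  using indep_setD_ev2[OF indep] by (auto simp: subalgebra_def paths_def)

lemma measurable_paths: "f \<in> measurable paths N \<Longrightarrow> f \<in> measurable M N"
  by (rule measurable_from_subalg[OF subalgebra_paths])

lemma path_pair_measurable:
  "(\<lambda>\<omega>. (path_of G \<omega>, path_of H \<omega>)) \<in> measurable paths (path_space \<Otimes>\<^sub>M path_space)"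
  unfolding paths_def
  by (rule measurable_vimage_algebra1) (auto simp: space_pair_measure space_PiM path_of_def)

lemma path_measurable:
  "path_of G \<in> measurable paths path_space" "path_of H \<in> measurable paths path_space"
  using measurable_compose[OF path_pair_measurable measurable_fst]
    measurable_compose[OF path_pair_measurable measurable_snd] by simp_all

lemma component_measurable:
  assumes "0 \<le> t"
  shows "G t \<in> borel_measurable paths" "H t \<in> borel_measurable paths"
proof -
  have t: "(\<lambda>p. p t) \<in> borel_measurable path_space"
    using assms by (intro measurable_component_singleton) auto
  show "G t \<in> borel_measurable paths" "H t \<in> borel_measurable paths"
    using measurable_compose[OF path_measurable(1) t] measurable_compose[OF path_measurable(2) t] assms
    by (simp_all add: path_of_def)
qed

text \<open>\<open>W\<close> is a sum of two products of an indicator of \<open>Z\<close> with a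
  function of the paths, and each product factorizes by independence. Integrability of the mixture,
  its law on path space and its martingale identity are all instances.\<close>

lemma expectation_mix:
  fixes V\<^sub>1 V\<^sub>0 W :: "'a \<Rightarrow> real"
  assumes V: "V\<^sub>1 \<in> borel_measurable paths" "V\<^sub>0 \<in> borel_measurable paths"
    and int: "integrable M V\<^sub>1" "integrable M V\<^sub>0"
    and W: "\<And>\<omega>. \<omega> \<in> space M \<Longrightarrow> W \<omega> = (if Z \<omega> = 1 then V\<^sub>1 \<omega> else V\<^sub>0 \<omega>)"
  shows "integrable M W" "expectation W = c * expectation V\<^sub>1 + (1 - c) * expectation V\<^sub>0"
proof -
  let ?Z = "vimage_algebra (space M) Z (count_space UNIV)"
  let ?I = "\<lambda>z \<omega>. indicator {z} (Z \<omega>) :: real"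
  have sZ: "subalgebra M ?Z"
    using indep_setD_ev1[OF indep] by (auto simp: subalgebra_def)
  have Zm: "Z \<in> measurable ?Z (count_space UNIV)"
    by (rule measurable_vimage_algebra1) auto
  have Im: "?I z \<in> borel_measurable ?Z" for z
    by (rule measurable_compose[OF Zm]) simp
  have Ii: "integrable M (?I z)" for z
    by (rule integrable_const_bound[where B = 1])
       (auto simp: indicator_def intro!: measurable_from_subalg[OF sZ Im])
  note ind = indep_set_expectation_mult[OF indep[folded paths_def] sZ subalgebra_paths Im]
  have "expectation (?I 1) = expectation (indicator {\<omega>\<in>space M. Z \<omega> = 1})"
    by (intro Bochner_Integration.integral_cong) (auto simp: indicator_def)
  then have E1: "expectation (?I 1) = c"
    using Zc by simp
  have "expectation (?I 0) = expectation (\<lambda>\<omega>. 1 - ?I 1 \<omega>)"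
    using Z01 by (intro Bochner_Integration.integral_cong) (fastforce simp: indicator_def)+
  then have E0: "expectation (?I 0) = 1 - c"
    using Ii[of 1] E1 by (simp add: prob_space)
  have W': "W \<omega> = ?I 1 \<omega> * V\<^sub>1 \<omega> + ?I 0 \<omega> * V\<^sub>0 \<omega>" if "\<omega> \<in> space M" for \<omega>
    using W[OF that] Z01[OF that] by auto
  have i: "integrable M (\<lambda>\<omega>. ?I 1 \<omega> * V\<^sub>1 \<omega>)" "integrable M (\<lambda>\<omega>. ?I 0 \<omega> * V\<^sub>0 \<omega>)"
    using ind(1)[OF V(1) Ii int(1)] ind(1)[OF V(2) Ii int(2)] by auto
  then have "integrable M (\<lambda>\<omega>. ?I 1 \<omega> * V\<^sub>1 \<omega> + ?I 0 \<omega> * V\<^sub>0 \<omega>)" by simp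
  then show "integrable M W"
    by (subst Bochner_Integration.integrable_cong[OF refl W'])
  have "expectation W = expectation (\<lambda>\<omega>. ?I 1 \<omega> * V\<^sub>1 \<omega> + ?I 0 \<omega> * V\<^sub>0 \<omega>)"
    using W' by (intro Bochner_Integration.integral_cong) auto
  also have "\<dots> = expectation (\<lambda>\<omega>. ?I 1 \<omega> * V\<^sub>1 \<omega>) + expectation (\<lambda>\<omega>. ?I 0 \<omega> * V\<^sub>0 \<omega>)"
    using i by (rule Bochner_Integration.integral_add)
  also have "\<dots> = c * expectation V\<^sub>1 + (1 - c) * expectation V\<^sub>0"
    using ind(2)[OF V(1) Ii int(1)] ind(2)[OF V(2) Ii int(2)] E1 E0 by (simp only:)
  finally show "expectation W = c * expectation V\<^sub>1 + (1 - c) * expectation V\<^sub>0" .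
qed

lemma mix_measurable:
  assumes "0 \<le> t"
  shows "mix t \<in> borel_measurable M"
proof -
  have [measurable]: "G t \<in> borel_measurable M" "H t \<in> borel_measurable M"
    using component_measurable[OF assms] measurable_paths by auto
  have "(\<lambda>\<omega>. if Z \<omega> = 1 then G t \<omega> else H t \<omega>) \<in> borel_measurable M" by measurable
  then show ?thesis using measurable_cong[of M "mix t", OF mix_eq] by blast
qed

lemma path_mix_measurable: "path_of mix \<in> measurable M path_space"
proof -
  have "(\<lambda>\<omega>. \<lambda>t\<in>{0..}. mix t \<omega>) \<in> measurable M path_space"
    by (intro measurable_restrict mix_measurable) simp
  then show ?thesis by (simp add: path_of_def[abs_def])
qed

text \<open>Since \<open>Z\<close> does not vary with time, the whole path is switched at once, so
  the indicator of a path event is itself of the form treated by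
  \<open>expectation_mix\<close>.\<close>

lemma prob_mix:
  assumes E: "E \<in> sets path_space"
  shows "prob {\<omega>\<in>space M. path_of mix \<omega> \<in> E} =
    c * prob {\<omega>\<in>space M. path_of G \<omega> \<in> E} + (1 - c) * prob {\<omega>\<in>space M. path_of H \<omega> \<in> E}"
proof -
  have ev: "{\<omega>\<in>space M. path_of Y \<omega> \<in> E} \<in> events" if "path_of Y \<in> measurable M path_space" for Y
    using measurable_sets[OF that E] by (simp add: vimage_def Int_def conj_commute)
  have eq: "expectation (\<lambda>\<omega>. indicator E (path_of Y \<omega>) :: real) = prob {\<omega>\<in>space M. path_of Y \<omega> \<in> E}"
    if "path_of Y \<in> measurable M path_space" for Y
  proof -
    have "expectation (\<lambda>\<omega>. indicator E (path_of Y \<omega>) :: real) =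
        expectation (indicator {\<omega>\<in>space M. path_of Y \<omega> \<in> E})"
      by (intro Bochner_Integration.integral_cong) (auto simp: indicator_def)
    then show ?thesis using ev[OF that] by simp
  qed
  have m: "(\<lambda>\<omega>. indicator E (path_of G \<omega>) :: real) \<in> borel_measurable paths"
    "(\<lambda>\<omega>. indicator E (path_of H \<omega>) :: real) \<in> borel_measurable paths"
    using E by (auto intro!: measurable_compose[OF path_measurable(1)] measurable_compose[OF path_measurable(2)])
  have "integrable M (\<lambda>\<omega>. indicator E (path_of G \<omega>) :: real)"
    "integrable M (\<lambda>\<omega>. indicator E (path_of H \<omega>) :: real)"
    by (rule integrable_const_bound[where B = 1];
        use measurable_paths[OF m(1)] measurable_paths[OF m(2)] in \<open>auto simp: indicator_def\<close>)+
  note E = expectation_mix(2)[OF m this, of "\<lambda>\<omega>. indicator E (path_of mix \<omega>)"]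
  have "path_of mix \<omega> = (if Z \<omega> = 1 then path_of G \<omega> else path_of H \<omega>)" if "\<omega> \<in> space M" for \<omega>
    using mix_eq[OF that] by (auto simp: path_of_def)
  then show ?thesis
    using E eq path_measurable[THEN measurable_paths] path_mix_measurable by simp
qed

lemma observed_pair_measurable:
  "(\<lambda>\<omega>. (Z \<omega>, \<lambda>s\<in>{0..t}. mix s \<omega>)) \<in> measurable (observed_filtration M Z mix t)
     (count_space UNIV \<Otimes>\<^sub>M (\<Pi>\<^sub>M s\<in>{0..t}. borel))"
  unfolding observed_filtration_def
  by (rule measurable_vimage_algebra1) (auto simp: space_pair_measure space_PiM)

lemma observed_measurable_Z: "Z \<in> measurable (observed_filtration M Z mix t) (count_space UNIV)"
  using measurable_compose[OF observed_pair_measurable measurable_fst] by simp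

lemma observed_measurable_mix:
  assumes "s \<in> {0..t}"
  shows "mix s \<in> borel_measurable (observed_filtration M Z mix t)"
  using measurable_compose[OF measurable_compose[OF observed_pair_measurable measurable_snd]
      measurable_component_singleton[OF assms]] assms by simp

text \<open>Minimality of a generated sigma-algebra. It gives both that the observed sigma-algebras
  are contained in \<open>M\<close> and that they increase with time.\<close>

lemma observed_filtration_sub:
  assumes N: "space N = space M" and Z: "Z \<in> measurable N (count_space UNIV)"
    and mix: "\<And>s. s \<in> {0..t} \<Longrightarrow> mix s \<in> borel_measurable N"
  shows "sets (observed_filtration M Z mix t) \<subseteq> sets N"
  unfolding observed_filtration_def
  by (intro sets_image_in_sets N measurable_Pair Z measurable_restrict mix)

lemma filtration_on_observed: "filtration_on M (observed_filtration M Z mix)"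
proof -
  have space: "space (observed_filtration M Z mix t) = space M" for t
    by (simp add: observed_filtration_def)
  have "sets (observed_filtration M Z mix t) \<subseteq> sets M" for t
    by (rule observed_filtration_sub) (auto intro: mix_measurable)
  moreover have "sets (observed_filtration M Z mix s) \<subseteq> sets (observed_filtration M Z mix t)"
    if "s \<le> t" for s t
    using that
    by (intro observed_filtration_sub space observed_measurable_Z observed_measurable_mix) auto
  ultimately show ?thesis
    using space by (auto simp: filtration_on_def filtration_def subalgebra_def)
qed

text \<open>As \<open>Z\<close> is part of the observation, an observed event restricted to a value
  of \<open>Z\<close> is an event of the past of \<open>G\<close> or of \<open>H\<close> alone. The
  identity to be shown thus splits into those of the two components, with weights \<open>c\<close>
  and \<open>1 - c\<close>.\<close>

lemma martingale_mix:
  assumes int: "\<And>t. 0 \<le> t \<Longrightarrow> integrable M (G t)" "\<And>t. 0 \<le> t \<Longrightarrow> integrable M (H t)"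
    and G: "\<And>s t C. 0 \<le> s \<Longrightarrow> s \<le> t \<Longrightarrow> C \<in> sets (\<Pi>\<^sub>M u\<in>{0..s}. borel) \<Longrightarrow>
      expectation (\<lambda>\<omega>. indicator C (\<lambda>u\<in>{0..s}. G u \<omega>) * G t \<omega>) =
      expectation (\<lambda>\<omega>. indicator C (\<lambda>u\<in>{0..s}. G u \<omega>) * G s \<omega>)"
    and H: "\<And>s t C. 0 \<le> s \<Longrightarrow> s \<le> t \<Longrightarrow> C \<in> sets (\<Pi>\<^sub>M u\<in>{0..s}. borel) \<Longrightarrow>
      expectation (\<lambda>\<omega>. indicator C (\<lambda>u\<in>{0..s}. H u \<omega>) * H t \<omega>) =
      expectation (\<lambda>\<omega>. indicator C (\<lambda>u\<in>{0..s}. H u \<omega>) * H s \<omega>)"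
  shows "martingale M (observed_filtration M Z mix) mix"
  unfolding martingale_def
proof (intro conjI allI impI filtration_on_observed)
  fix t :: real assume t: "0 \<le> t"
  show "mix t \<in> borel_measurable (observed_filtration M Z mix t)"
    using t by (intro observed_measurable_mix) auto
  show "integrable M (mix t)"
    using expectation_mix(1)[OF component_measurable[OF t] int(1)[OF t] int(2)[OF t] mix_eq] .
next
  fix s t :: real assume st: "0 \<le> s" "s \<le> t"
  let ?O = "observed_filtration M Z mix"
  have imix: "integrable M (mix u)" if "0 \<le> u" for u
    using expectation_mix(1)[OF component_measurable[OF that] int(1)[OF that] int(2)[OF that] mix_eq] .
  have sub: "subalgebra M (?O s)"
    using filtration_on_observed by (auto simp: filtration_on_def)
  interpret S: sigma_finite_subalgebra M "?O s"
    by (intro finite_measure_subalgebra_is_sigma_finite finite_measure_subalgebra.intro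
        finite_measure_subalgebra_axioms.intro sub finite_measure_axioms)
  show "AE \<omega> in M. real_cond_exp M (?O s) (mix t) \<omega> = mix s \<omega>"
  proof (rule S.real_cond_exp_charact)
    fix A assume "A \<in> sets (?O s)"
    then have "A \<in> {(\<lambda>\<omega>. (Z \<omega>, \<lambda>u\<in>{0..s}. mix u \<omega>)) -` D \<inter> space M | D.
        D \<in> sets (count_space UNIV \<Otimes>\<^sub>M (\<Pi>\<^sub>M u\<in>{0..s}. borel))}"
      unfolding observed_filtration_def
      by (subst (asm) sets_vimage_algebra2) (auto simp: space_pair_measure space_PiM)
    then obtain D where A: "A = (\<lambda>\<omega>. (Z \<omega>, \<lambda>u\<in>{0..s}. mix u \<omega>)) -` D \<inter> space M"
      and D: "D \<in> sets (count_space UNIV \<Otimes>\<^sub>M (\<Pi>\<^sub>M u\<in>{0..s}. borel))" by auto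
    define C where "C z = Pair z -` D" for z
    have C: "C z \<in> sets (\<Pi>\<^sub>M u\<in>{0..s}. borel)" for z
      unfolding C_def by (rule sets_Pair1[OF D])
    let ?V = "\<lambda>Y z u \<omega>. indicator (C z) (\<lambda>u\<in>{0..s}. Y u \<omega>) * Y u \<omega> :: real"
    have Vm: "?V G z u \<in> borel_measurable paths" "?V H z u \<in> borel_measurable paths" if "0 \<le> u" for z u
    proof -
      have "(\<lambda>\<omega>. \<lambda>u\<in>{0..s}. G u \<omega>) \<in> measurable paths (\<Pi>\<^sub>M u\<in>{0..s}. borel)"
        "(\<lambda>\<omega>. \<lambda>u\<in>{0..s}. H u \<omega>) \<in> measurable paths (\<Pi>\<^sub>M u\<in>{0..s}. borel)"
        by (intro measurable_restrict component_measurable; simp)+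
      from this[THEN measurable_compose[OF _ borel_measurable_indicator[OF C]]]
      show "?V G z u \<in> borel_measurable paths" "?V H z u \<in> borel_measurable paths"
        using component_measurable[OF that] by (auto intro!: borel_measurable_times)
    qed
    have Vi: "integrable M (?V G z u)" "integrable M (?V H z u)" if "0 \<le> u" for z u
      by (rule Bochner_Integration.integrable_bound[OF int(1)[OF that]],
          use Vm(1)[OF that] measurable_paths in \<open>auto simp: indicator_def\<close>)
         (rule Bochner_Integration.integrable_bound[OF int(2)[OF that]],
          use Vm(2)[OF that] measurable_paths in \<open>auto simp: indicator_def\<close>)
    have "(\<integral>\<omega>\<in>A. mix u \<omega> \<partial>M) = c * expectation (?V G 1 u) + (1 - c) * expectation (?V H 0 u)"
      if u: "0 \<le> u" for u
      unfolding set_lebesgue_integral_def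
    proof (rule expectation_mix(2)[OF Vm(1)[OF u] Vm(2)[OF u] Vi(1)[OF u] Vi(2)[OF u]])
      fix \<omega> assume \<omega>: "\<omega> \<in> space M"
      show "indicator A \<omega> *\<^sub>R mix u \<omega> = (if Z \<omega> = 1 then ?V G 1 u \<omega> else ?V H 0 u \<omega>)"
        using Z01[OF \<omega>] \<omega> by (auto simp: A C_def mix_eq indicator_def cong: restrict_cong)
    qed
    then show "(\<integral>\<omega>\<in>A. mix t \<omega> \<partial>M) = (\<integral>\<omega>\<in>A. mix s \<omega> \<partial>M)"
      using st G[OF st C] H[OF st C] by simp
  next
    show "mix s \<in> borel_measurable (?O s)"
      using st by (intro observed_measurable_mix) auto
  qed (use st imix in auto)
qed

end

subsection \<open>The law of the mixture\<close>

text \<open>At positive times the derivative within the half-line is the ordinary one, so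
  \<open>deriv a\<close> is the derivative supplied by \<open>C2_on\<close>.\<close>

lemma C2_on_nonneg_imp_DERIV:
  assumes "C2_on {0..} a" "0 < t"
  shows "(a has_real_derivative deriv a t) (at t)"
proof -
  obtain a' where "(a has_real_derivative a' t) (at t within {0..})"
    using assms by (force simp: C2_on_def)
  moreover have "at t within {0..} = at t"
    using assms(2) by (intro at_within_interior) simp
  ultimately have "(a has_real_derivative a' t) (at t)" by simp
  then show ?thesis using DERIV_imp_deriv by metis
qed

lemma C2_on_imp_continuous_on: "C2_on S a \<Longrightarrow> continuous_on S a"
  unfolding C2_on_def by (auto intro: DERIV_continuous_on)

lemma standing_assumptions_brownian:
  assumes "prob_space M" "standing_assumptions M F B l r x\<^sub>0 \<sigma> f X"
  shows "brownian M F B"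
  using assms
  by (auto simp: standing_assumptions_def martingale_diffusion_def brownian_def brownian_axioms_def)

text \<open>On \<open>{Z = 1}\<close> the quadratic variation of the mixture over a short interval after time 1 is too
  small: it is about \<open>deriv a 1 < 1\<close> times what the value of the path at time 1 requires.\<close>

lemma (in mixture) process_law_mix_neq:
  assumes sa: "standing_assumptions M F B l r x\<^sub>0 \<sigma> f X"
    and a: "strict_mono_on {0..} a" "C2_on {0..} a" "a 0 = 0" "deriv a 1 < 1"
    and G: "\<And>t \<omega>. 0 \<le> t \<Longrightarrow> \<omega> \<in> space M \<Longrightarrow> G t \<omega> = X (a t) \<omega>"
    and c: "0 < c" "c < 1"
  shows "process_law M mix \<noteq> process_law M X"
proof
  assume eq: "process_law M mix = process_law M X"
  interpret brownian M F B
    by (rule standing_assumptions_brownian[OF prob_space_axioms sa])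
  define I where "I = einterval l r"
  define J where "J = (\<lambda>t \<omega>. X t \<omega> - X 0 \<omega>)"
  have ito: "ito_integral M F B (\<lambda>t \<omega>. \<sigma> (X t \<omega>)) J"
    and mart: "martingale M F X" and cX: "continuous_paths M X"
    and XI: "\<And>\<omega> t. \<omega> \<in> space M \<Longrightarrow> 0 \<le> t \<Longrightarrow> X t \<omega> \<in> I"
    and \<sigma>pos: "\<And>x. x \<in> I \<Longrightarrow> 0 < \<sigma> x" and \<sigma>C1: "\<sigma> C1_differentiable_on I"
    using sa by (auto simp: standing_assumptions_def martingale_diffusion_def I_def J_def)
  have \<sigma>cont: "continuous_on I \<sigma>"
    using \<sigma>C1 by (rule C1_differentiable_imp_continuous_on)
  \<comment> \<open>\<sigma> is unconstrained outside \<open>I\<close>; its extension by zero is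
    Borel on the whole line, which makes \<open>E\<close> below an event of path space.\<close>
  define \<sigma>' where "\<sigma>' = (\<lambda>x. indicator I x *\<^sub>R \<sigma> x)"
  have [measurable]: "\<sigma>' \<in> borel_measurable borel"
    unfolding \<sigma>'_def by (rule borel_measurable_continuous_on_indicator[OF _ \<sigma>cont]) (simp add: I_def)
  have \<sigma>': "\<sigma>' (X t \<omega>) = \<sigma> (X t \<omega>)" if "\<omega> \<in> space M" "0 \<le> t" for t \<omega>
    using XI[OF that] by (simp add: \<sigma>'_def)
  have Xm: "X t \<in> borel_measurable (F t)" if "0 \<le> t" for t
    using mart that by (auto simp: martingale_def)
  have \<phi>m: "(\<lambda>\<omega>. \<sigma> (X t \<omega>)) \<in> borel_measurable (F t)" if "0 \<le> t" for t
  proof -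
    have "(\<lambda>\<omega>. \<sigma>' (X t \<omega>)) \<in> borel_measurable (F t)"
      using Xm[OF that] by measurable
    then show ?thesis
      using measurable_cong[of "F t" "\<lambda>\<omega>. \<sigma>' (X t \<omega>)" "\<lambda>\<omega>. \<sigma> (X t \<omega>)" borel] \<sigma>' that by simp
  qed
  have \<phi>pos: "0 < \<sigma> (X t \<omega>)" if "\<omega> \<in> space M" "0 \<le> t" for t \<omega>
    using \<sigma>pos XI that by simp
  have \<phi>cont: "continuous_on {0..} (\<lambda>u. \<sigma> (X u \<omega>))" if "\<omega> \<in> space M" for \<omega>
    using cX that XI by (intro continuous_on_compose2[OF \<sigma>cont]) (auto simp: continuous_paths_def)
  \<comment> \<open>A number strictly between \<open>deriv a 1\<close> and 1; the maximum with 0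
    keeps it positive.\<close>
  define q where "q = (1 + max (deriv a 1) 0) / 2"
  have q: "deriv a 1 < q" "0 < q" "q < 1" using a(4) by (auto simp: q_def)
  have "((\<lambda>h. (a (1 + h) - a 1) / h) \<longlongrightarrow> deriv a 1) (at 0)"
    using C2_on_nonneg_imp_DERIV[OF a(2), of 1] by (simp add: DERIV_def)
  from order_tendstoD(2)[OF this q(1)]
  obtain d where d: "0 < d" "\<And>h. h \<noteq> 0 \<Longrightarrow> \<bar>h\<bar> < d \<Longrightarrow> (a (1 + h) - a 1) / h < q"
    by (auto simp: eventually_at dist_real_def)
  \<comment> \<open>The factor \<open>d / 2\<close> keeps every \<open>\<delta> j\<close> in the
    range where the difference quotient of \<open>a\<close> at 1 is below \<open>q\<close>.\<close>
  define \<delta> where "\<delta> = (\<lambda>j. d / 2 * inverse (real (Suc j)))"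
  have \<delta>: "0 < \<delta> j" for j using d(1) by (simp add: \<delta>_def)
  have \<delta>0: "\<delta> \<longlonglongrightarrow> 0"
    unfolding \<delta>_def using tendsto_mult_right_zero[OF LIMSEQ_inverse_real_of_nat] by blast
  have "\<delta> j < d" for j
  proof -
    have "inverse (real (Suc j)) \<le> 1" by (simp add: inverse_le_1_iff)
    then have "d / 2 * inverse (real (Suc j)) \<le> d / 2 * 1"
      using d(1) by (intro mult_left_mono) auto
    then show ?thesis using d(1) by (simp add: \<delta>_def)
  qed
  then have a\<delta>: "a (1 + \<delta> j) - a 1 \<le> q * \<delta> j" for j
    using d(2)[of "\<delta> j"] \<delta>[of j] by (simp add: divide_less_eq less_imp_le)
  \<comment> \<open>With this \<eta> one has 1 - 4\<eta> = (1 + q)/2, so the Markov bound for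
    \<open>G\<close> is 2q/(1 + q) = 1 - P, with a gap \<open>P\<close> fixed before
    \<open>n\<close> and \<delta> are chosen.\<close>
  define \<eta> where "\<eta> = (1 - q) / 8"
  have \<eta>: "0 < \<eta>" "\<eta> < 1" "4 * \<eta> < 1" using q by (auto simp: \<eta>_def)
  define P where "P = (1 - q) / (1 + q)"
  have P: "0 < P" using q by (simp add: P_def)
  have qP: "q / (1 - 4 * \<eta>) = 1 - P"
    using q by (simp add: \<eta>_def P_def field_simps)
  obtain n where n: "0 < n" "8 / (real n * \<eta>\<^sup>2) < c * P / 4"
  proof -
    obtain n where n: "0 < n" "inverse (real n) < c * P / 4 * \<eta>\<^sup>2 / 8"
      using ex_inverse_of_nat_less[of "c * P / 4 * \<eta>\<^sup>2 / 8"]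
        c P \<eta> by auto
    then have "8 / (real n * \<eta>\<^sup>2) < c * P / 4"
      using \<eta> by (simp add: field_simps)
    with n that show ?thesis by blast
  qed
  define p where "p = (\<lambda>j k. 1 + real k * \<delta> j / real n)"
  have p0: "0 \<le> p j k" "0 \<le> p j (Suc k)" for j k
    using \<delta>[of j] by (auto simp: p_def intro!: add_nonneg_nonneg divide_nonneg_nonneg)
  have p_mono: "p j k < p j (Suc k)" for j k
    using \<delta>[of j] n(1) by (simp add: p_def divide_strict_right_mono)
  have pn: "p j n = 1 + \<delta> j" "p j 0 = 1" for j using n(1) by (auto simp: p_def)
  \<comment> \<open>The paths whose increments after time 1 are too small for their value at time 1.
    This will be unlikely for \<open>X\<close>, while for \<open>G\<close> its probability exceeds
    3P/4.\<close>
  define E where "E = (\<lambda>j. {w\<in>space path_space.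
    L2_set (\<lambda>k. w (p j (Suc k)) - w (p j k)) {..<n} < (1 - \<eta>) * \<sigma>' (w 1) * sqrt (\<delta> j)})"
  have E: "E j \<in> sets path_space" for j
  proof -
    have [measurable]: "(\<lambda>w. w t) \<in> borel_measurable path_space" if "0 \<le> t" for t :: real
      using that by (intro measurable_component_singleton) auto
    show ?thesis
      unfolding E_def L2_set_def using p0 by measurable
  qed
  have pathX: "path_of X \<in> measurable M path_space"
    unfolding path_of_def[abs_def] using Xm measurable_F by (intro measurable_restrict) auto
  have law: "prob {\<omega>\<in>space M. path_of mix \<omega> \<in> E j} = prob {\<omega>\<in>space M. path_of X \<omega> \<in> E j}" for j
  proof -
    have "measure (process_law M mix) (E j) = measure (process_law M X) (E j)" by (simp add: eq)
    then show ?thesis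
      using E pathX path_mix_measurable
      by (simp add: process_law_def measure_distr vimage_def Int_def conj_commute)
  qed
  have inX: "{\<omega>\<in>space M. path_of X \<omega> \<in> E j} = {\<omega>\<in>space M.
      L2_set (\<lambda>k. J (p j (Suc k)) \<omega> - J (p j k) \<omega>) {..<n} < (1 - \<eta>) * \<sigma> (X 1 \<omega>) * sqrt (\<delta> j)}" for j
    using \<sigma>'[of _ 1] p0 by (auto simp: E_def path_of_def J_def space_PiM)
  have a0: "0 \<le> a t" if "0 \<le> t" for t
    using strict_mono_on_leD[OF a(1), of 0 t] that a(3) by auto
  \<comment> \<open>The clock of \<open>G\<close> turns the equidistant grid into an irregular one,
    which starts at 0 because \<open>p j 0 = 1\<close> and has length at most
    \<open>q * \<delta> j\<close>.\<close>
  define \<tau> where "\<tau> = (\<lambda>j k. a (p j k) - a 1)"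
  have inG: "{\<omega>\<in>space M. path_of G \<omega> \<notin> E j} = {\<omega>\<in>space M. (1 - \<eta>) * \<sigma> (X (a 1) \<omega>) * sqrt (\<delta> j) \<le>
      L2_set (\<lambda>k. J (a 1 + \<tau> j (Suc k)) \<omega> - J (a 1 + \<tau> j k) \<omega>) {..<n}}" for j
    using \<sigma>'[of _ "a 1"] p0 a0[of 1]
    by (auto simp: E_def path_of_def J_def \<tau>_def G space_PiM not_less)
  have 1: "\<forall>\<^sub>F j in sequentially. prob {\<omega>\<in>space M. path_of X \<omega> \<in> E j} < 8 / (real n * \<eta>\<^sup>2) + c * P / 4"
    unfolding inX p_def
    by (rule ito_increments_lower[where \<phi> = "\<lambda>t \<omega>. \<sigma> (X t \<omega>)", OF ito _ \<phi>m \<phi>pos \<phi>cont \<delta> \<delta>0 n(1) \<eta>(1,2)])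
       (use c P in auto)
  have 2: "\<forall>\<^sub>F j in sequentially. prob {\<omega>\<in>space M. path_of G \<omega> \<notin> E j} < q / (1 - 4 * \<eta>) + P / 4"
    unfolding inG
  proof (rule ito_increments_upper[where \<phi> = "\<lambda>t \<omega>. \<sigma> (X t \<omega>)", OF ito a0 \<phi>m[OF a0] \<phi>pos \<phi>cont _ _ _ _ \<delta> \<delta>0 \<eta>(1,3)])
    show "\<tau> j 0 = 0" "\<tau> j k < \<tau> j (Suc k)" "\<tau> j n \<le> q * \<delta> j" for j k
      using strict_mono_onD[OF a(1), of "p j k" "p j (Suc k)"] p0 p_mono a\<delta> by (auto simp: \<tau>_def pn)
  qed (use q P a0 in auto)
  from eventually_happens[OF eventually_conj[OF 1 2]]
  obtain j where X: "prob {\<omega>\<in>space M. path_of X \<omega> \<in> E j} < 8 / (real n * \<eta>\<^sup>2) + c * P / 4"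
    and Gj: "prob {\<omega>\<in>space M. path_of G \<omega> \<notin> E j} < q / (1 - 4 * \<eta>) + P / 4"
    by auto
  have evG: "{\<omega>\<in>space M. path_of G \<omega> \<in> E j} \<in> events"
    using measurable_sets[OF measurable_paths[OF path_measurable(1)] E]
    by (simp add: vimage_def Int_def conj_commute)
  have "{\<omega>\<in>space M. path_of G \<omega> \<notin> E j} = space M - {\<omega>\<in>space M. path_of G \<omega> \<in> E j}" by auto
  then have "prob {\<omega>\<in>space M. path_of G \<omega> \<notin> E j} = 1 - prob {\<omega>\<in>space M. path_of G \<omega> \<in> E j}"
    using prob_compl[OF evG] by simp
  then have "3 * P / 4 < prob {\<omega>\<in>space M. path_of G \<omega> \<in> E j}"
    using Gj qP by linarith
  \<comment> \<open>The mixture inherits more than 3cP/4 from \<open>G\<close>, whereas equality of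
    the laws would cap the probability at cP/2.\<close>
  then have "c * (3 * P / 4) < c * prob {\<omega>\<in>space M. path_of G \<omega> \<in> E j}"
    using c by simp
  also have "\<dots> \<le> prob {\<omega>\<in>space M. path_of mix \<omega> \<in> E j}"
    using c by (simp add: prob_mix[OF E])
  also have "\<dots> < c * P / 4 + c * P / 4"
    using X n(2) law[of j] by linarith
  finally have "c * P < 0" by (simp add: mult.commute)
  moreover have "0 < c * P" using c P by simp
  ultimately show False by simp
qed

text \<open>Since x/0 = 0, a positive infimum forces the denominator to be positive, and the
  quotient can be cleared pointwise. The bound on \<open>K\<close> then comes from both densities
  having total mass one.\<close>

lemma density_ratio_bound:
  fixes f :: "real \<Rightarrow> real \<Rightarrow> real"
  assumes "prob_space M" and sa: "standing_assumptions M F B l r x\<^sub>0 \<sigma> f X"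
    and a: "\<And>t. 0 < t \<Longrightarrow> 0 < a t"
    and K: "K = (INF t\<in>{0<..}. INF y\<in>einterval l r. f t y / f (a t) y)"
  shows "0 < t \<Longrightarrow> y \<in> einterval l r \<Longrightarrow> 0 < K \<Longrightarrow> K * f (a t) y \<le> f t y"
    and "K \<le> 1"
proof -
  interpret prob_space M by fact
  let ?I = "einterval l r"
  let ?g = "\<lambda>t y. f t y / f (a t) y"
  have f: "0 \<le> f t y" if "0 < t" "y \<in> ?I" for t y
    using sa that by (auto simp: standing_assumptions_def)
  have g: "0 \<le> ?g t y" if "0 < t" "y \<in> ?I" for t y
    using f[OF that] f[OF a that(2)] that by simp
  have "x\<^sub>0 \<in> ?I" using sa by (auto simp: standing_assumptions_def einterval_def)
  then have ne: "?I \<noteq> {}" by auto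
  have Kg: "K \<le> ?g t y" if "0 < t" "y \<in> ?I" for t y
  proof -
    have "K \<le> (INF y\<in>?I. ?g t y)"
      \<comment> \<open>Infima of reals are lower bounds only for sets bounded below; nonnegativity
        of the quotients provides this for both levels, together with \<open>I\<close> being
        nonempty.\<close>
      unfolding K using that ne g
      by (intro cINF_lower bdd_belowI2[where m = 0] cINF_greatest) auto
    also have "\<dots> \<le> ?g t y"
      using that g by (intro cINF_lower bdd_belowI2[where m = 0]) auto
    finally show ?thesis .
  qed
  have Kf: "K * f (a t) y \<le> f t y" if "0 < t" "y \<in> ?I" "0 < K" for t y
  proof -
    have "0 < ?g t y" using Kg[OF that(1,2)] that(3) by simp
    then have "0 < f (a t) y"
      using f[OF a that(2)] that(1) by (cases "f (a t) y = 0") (auto simp: less_le)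
    then show ?thesis using Kg[OF that(1,2)] by (simp add: field_simps)
  qed
  then show "0 < t \<Longrightarrow> y \<in> ?I \<Longrightarrow> 0 < K \<Longrightarrow> K * f (a t) y \<le> f t y" .
  have D: "distributed M lborel (X t) (\<lambda>y. ennreal (f t y) * indicator ?I y)" if "0 < t" for t
    using sa that by (auto simp: standing_assumptions_def)
  have total: "(\<integral>\<^sup>+y. ennreal (f t y) * indicator ?I y \<partial>lborel) = 1" if "0 < t" for t
    using distributed_nn_integral[OF D[OF that], of "\<lambda>_. 1"] by (simp add: emeasure_space_1)
  show "K \<le> 1"
  proof (cases "0 < K")
    case True
    have "ennreal K = (\<integral>\<^sup>+y. ennreal K * (ennreal (f (a 1) y) * indicator ?I y) \<partial>lborel)"
      using total[OF a] distributed_borel_measurable[OF D[OF a]] by (subst nn_integral_cmult) auto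
    also have "\<dots> \<le> (\<integral>\<^sup>+y. ennreal (f 1 y) * indicator ?I y \<partial>lborel)"
      using Kf[of 1] f[OF a[of 1]] True
      by (intro nn_integral_mono) (auto simp: indicator_def ennreal_mult[symmetric] intro!: ennreal_leI)
    also have "\<dots> = 1" by (rule total) simp
    finally show ?thesis by simp
  qed simp
qed

section \<open>One-dimensional marginals and assembly of the fake version\<close>

lemma distr_eqI_prob:
  assumes "prob_space M" "X \<in> measurable M N" "Y \<in> measurable M N"
    and "\<And>A. A \<in> sets N \<Longrightarrow> measure M {\<omega>\<in>space M. X \<omega> \<in> A} = measure M {\<omega>\<in>space M. Y \<omega> \<in> A}"
  shows "distr M N X = distr M N Y"
proof (rule measure_eqI)
  interpret prob_space M by fact
  fix A assume "A \<in> sets (distr M N X)"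
  then have A: "A \<in> sets N" by simp
  have "X -` A \<inter> space M = {\<omega>\<in>space M. X \<omega> \<in> A}" "Y -` A \<inter> space M = {\<omega>\<in>space M. Y \<omega> \<in> A}" by auto
  then show "emeasure (distr M N X) A = emeasure (distr M N Y) A"
    using assms(2-4) A by (simp add: emeasure_distr emeasure_eq_measure)
qed simp

text \<open>A condition on the value at one time is a cylinder event of path space, so
  \<open>prob_mix\<close> already contains the marginals.\<close>

lemma (in mixture) distr_mix:
  assumes t: "0 \<le> t" and Y: "Y \<in> borel_measurable M"
    and eq: "\<And>A. A \<in> sets borel \<Longrightarrow> c * prob {\<omega>\<in>space M. G t \<omega> \<in> A} + (1 - c) * prob {\<omega>\<in>space M. H t \<omega> \<in> A} =
      prob {\<omega>\<in>space M. Y \<omega> \<in> A}"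
  shows "distr M borel (mix t) = distr M borel Y"
proof (rule distr_eqI_prob[OF prob_space_axioms mix_measurable[OF t] Y])
  fix A :: "real set" assume A: "A \<in> sets borel"
  have [measurable]: "(\<lambda>w. w t) \<in> borel_measurable path_space"
    using t by (intro measurable_component_singleton) auto
  have "{w\<in>space path_space. w t \<in> A} \<in> sets path_space"
    using A by measurable
  from prob_mix[OF this] show "prob {\<omega>\<in>space M. mix t \<omega> \<in> A} = prob {\<omega>\<in>space M. Y \<omega> \<in> A}"
    using t eq[OF A] by (simp add: path_of_def space_PiM)
qed

theorem theorem3p2:
  fixes M :: "'a measure" and F :: "real \<Rightarrow> 'a measure" and B X G H Xfake :: "real \<Rightarrow> 'a \<Rightarrow> real"
    and l r :: ereal and x\<^sub>0 c K :: real and \<sigma> a :: "real \<Rightarrow> real"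
    and f h :: "real \<Rightarrow> real \<Rightarrow> real" and Z :: "'a \<Rightarrow> nat"
  assumes "prob_space M"
    and "standing_assumptions M F B l r x\<^sub>0 \<sigma> f X"
    and "strict_mono_on {0..} a" and "C2_on {0..} a" and "a 0 = 0"
    and "\<forall>t>0. deriv a t < 1"
    and "K = (INF t\<in>{0<..}. INF y\<in>einterval l r. f t y / f (a t) y)"
    and "K > 0" and "0 < c" and "c < K"
    and "\<forall>t>0. \<forall>y\<in>einterval l r. h t y = 1 / (1 - c) * (f t y - c * f (a t) y)"
    and "\<forall>t\<ge>0. \<forall>\<omega>\<in>space M. G t \<omega> = X (a t) \<omega>"
    and "dupire_diffusion M (laws_of_densities (einterval l r) x\<^sub>0 h) H"
    and "Z \<in> measurable M (count_space UNIV)"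
    and "\<forall>\<omega>\<in>space M. Z \<omega> \<in> {0, 1}" and "measure M {\<omega>\<in>space M. Z \<omega> = 1} = c"
    and "prob_space.indep_set M (sets (vimage_algebra (space M) Z (count_space UNIV)))
           (sets (vimage_algebra (space M) (\<lambda>\<omega>. (path_of G \<omega>, path_of H \<omega>))
             (path_space \<Otimes>\<^sub>M path_space)))"
    and "Xfake = (\<lambda>t \<omega>. G t \<omega> * indicator {\<omega>. Z \<omega> = 1} \<omega> + H t \<omega> * indicator {\<omega>. Z \<omega> = 0} \<omega>)"
  shows "fake_version M (observed_filtration M Z Xfake) Xfake M X"
proof -
  note sa = assms(2)
  let ?I = "einterval l r"
  interpret mixture M Z c G H
    using assms(1,14-17) by (auto simp: mixture_def mixture_axioms_def)
  have Xfake: "Xfake = mix" using assms(18) by (simp add: mix_def)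
  have G: "G t \<omega> = X (a t) \<omega>" if "0 \<le> t" "\<omega> \<in> space M" for t \<omega>
    using assms(12) that by auto
  have a_mono: "a s < a t" if "0 \<le> s" "s < t" for s t
    using strict_mono_onD[OF assms(3), of s t] that by auto
  have a_pos: "0 < a t" if "0 < t" for t
    using a_mono[of 0 t] that assms(5) by simp
  have a_le: "0 \<le> a s \<and> a s \<le> a t" if "0 \<le> s" "s \<le> t" for s t
    using a_mono[of s t] a_pos[of s] that assms(5) by (cases "s = t"; cases "s = 0") auto
  have ratio: "K * f (a t) y \<le> f t y" if "0 < t" "y \<in> ?I" for t y
    by (rule density_ratio_bound(1)[OF assms(1) sa a_pos assms(7) that assms(8)])
  have "K \<le> 1"
    by (rule density_ratio_bound(2)[OF assms(1) sa a_pos assms(7)])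
  then have c: "0 < c" "c < 1" using assms(9,10) by auto
  have mX: "martingale M F X" and cX: "continuous_paths M X" and X0: "AE \<omega> in M. X 0 \<omega> = x\<^sub>0"
    and f: "\<And>t y. 0 < t \<Longrightarrow> y \<in> ?I \<Longrightarrow> 0 \<le> f t y"
    and D: "\<And>t. 0 < t \<Longrightarrow> distributed M lborel (X t) (\<lambda>y. ennreal (f t y) * indicator ?I y)"
    using sa by (auto simp: standing_assumptions_def martingale_diffusion_def)
  \<comment> \<open>The filtration of \<open>H\<close> is whatever the Dupire diffusion provides;
    \<open>martingale_time_change\<close> will remove it from the argument.\<close>
  obtain F' W where mH: "martingale M F' H" and cH: "continuous_paths M H"
    using assms(13) by (auto simp: dupire_diffusion_def martingale_diffusion_def)
  have lawH: "distr M borel (H t) = laws_of_densities ?I x\<^sub>0 h t" if "0 \<le> t" for t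
    using assms(13) that by (auto simp: dupire_diffusion_def)
  have iX: "integrable M (X t)" and iH: "integrable M (H t)" if "0 \<le> t" for t
    using mX mH that by (auto simp: martingale_def)
  have Xm: "X t \<in> borel_measurable M" if "0 \<le> t" for t using iX[OF that] by auto
  have Hm: "H t \<in> borel_measurable M" if "0 \<le> t" for t using iH[OF that] by auto
  have "martingale M (observed_filtration M Z mix) mix"
  proof (rule martingale_mix)
    show "integrable M (G t)" if "0 \<le> t" for t
      using iX[of "a t"] a_le[OF that order_refl] G[OF that]
        Bochner_Integration.integrable_cong[of M M "G t" "X (a t)"] by auto
    show "integrable M (H t)" if "0 \<le> t" for t by (rule iH[OF that])
    fix s t :: real and C :: "(real \<Rightarrow> real) set" assume st: "0 \<le> s" "s \<le> t" and C: "C \<in> sets (\<Pi>\<^sub>M u\<in>{0..s}. borel)"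
    show "expectation (\<lambda>\<omega>. indicator C (\<lambda>u\<in>{0..s}. H u \<omega>) * H t \<omega>) =
        expectation (\<lambda>\<omega>. indicator C (\<lambda>u\<in>{0..s}. H u \<omega>) * H s \<omega>)"
      using martingale_time_change[OF mH _ st C, of "\<lambda>u. u"] by simp
    have *: "expectation (\<lambda>\<omega>. indicator C (\<lambda>u\<in>{0..s}. G u \<omega>) * G v \<omega>) =
        expectation (\<lambda>\<omega>. indicator C (\<lambda>u\<in>{0..s}. X (a u) \<omega>) * X (a v) \<omega>)" if "0 \<le> v" for v
    proof (rule Bochner_Integration.integral_cong[OF refl])
      fix \<omega> assume \<omega>: "\<omega> \<in> space M"
      have "(\<lambda>u\<in>{0..s}. G u \<omega>) = (\<lambda>u\<in>{0..s}. X (a u) \<omega>)"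
        using G \<omega> by (intro restrict_ext) auto
      then show "indicator C (\<lambda>u\<in>{0..s}. G u \<omega>) * G v \<omega> =
          indicator C (\<lambda>u\<in>{0..s}. X (a u) \<omega>) * X (a v) \<omega>"
        using G[OF that \<omega>] by simp
    qed
    show "expectation (\<lambda>\<omega>. indicator C (\<lambda>u\<in>{0..s}. G u \<omega>) * G t \<omega>) =
        expectation (\<lambda>\<omega>. indicator C (\<lambda>u\<in>{0..s}. G u \<omega>) * G s \<omega>)"
      using martingale_time_change[OF mX a_le st C] st by (simp add: *)
  qed
  moreover have "continuous_paths M mix"
    unfolding continuous_paths_def
  proof
    fix \<omega> assume \<omega>: "\<omega> \<in> space M"
    have "continuous_on {0..} (\<lambda>t. X (a t) \<omega>)"
    proof (rule continuous_on_compose2[OF _ C2_on_imp_continuous_on[OF assms(4)]])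
      show "continuous_on {0..} (\<lambda>t. X t \<omega>)" using cX \<omega> by (simp add: continuous_paths_def)
    qed (use a_le in auto)
    then have "continuous_on {0..} (\<lambda>t. G t \<omega>)"
      using G[OF _ \<omega>] by (subst continuous_on_cong[OF refl, of _ _ "\<lambda>t. X (a t) \<omega>"]) auto
    moreover have "continuous_on {0..} (\<lambda>t. H t \<omega>)"
      using cH \<omega> by (auto simp: continuous_paths_def)
    ultimately show "continuous_on {0..} (\<lambda>t. mix t \<omega>)"
      using mix_eq[OF \<omega>] by (cases "Z \<omega> = 1") auto
  qed
  moreover have "distr M borel (mix t) = distr M borel (X t)" if t: "0 \<le> t" for t
  proof (rule distr_mix[OF t Xm[OF t]])
    fix A :: "real set" assume A: "A \<in> sets borel"
    have prob_G: "prob {\<omega>\<in>space M. G t \<omega> \<in> A} = prob {\<omega>\<in>space M. X (a t) \<omega> \<in> A}"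
      using G[OF t] by (intro arg_cong[where f = prob]) auto
    have H: "emeasure M {\<omega>\<in>space M. H t \<omega> \<in> A} = emeasure (laws_of_densities ?I x\<^sub>0 h t) A"
      using Hm[OF t] A lawH[OF t, symmetric]
      by (simp add: emeasure_distr vimage_def Int_def conj_commute)
    show "c * prob {\<omega>\<in>space M. G t \<omega> \<in> A} + (1 - c) * prob {\<omega>\<in>space M. H t \<omega> \<in> A} =
        prob {\<omega>\<in>space M. X t \<omega> \<in> A}"
    proof (cases "t = 0")
      case True
      \<comment> \<open>At time 0 there is no density: \<open>H 0\<close> has the unit mass as its
        law, and \<open>X 0\<close> equals the starting point almost surely, so any convex
        combination agrees.\<close>
      have "emeasure M {\<omega>\<in>space M. X 0 \<omega> \<in> A} = emeasure M {\<omega>\<in>space M. x\<^sub>0 \<in> A}"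
        using X0 Xm[of 0] A by (intro emeasure_eq_AE) auto
      also have "\<dots> = indicator A x\<^sub>0" by (auto simp: indicator_def emeasure_space_1)
      finally have "emeasure M {\<omega>\<in>space M. X 0 \<omega> \<in> A} = emeasure M {\<omega>\<in>space M. H 0 \<omega> \<in> A}"
        using H A True by (simp add: laws_of_densities_def)
      then have "prob {\<omega>\<in>space M. X 0 \<omega> \<in> A} = prob {\<omega>\<in>space M. H 0 \<omega> \<in> A}"
        by (simp add: measure_def)
      then show ?thesis using True assms(5) prob_G by (simp add: algebra_simps)
    next
      case False
      then have t: "0 < t" using t by simp
      \<comment> \<open>Densities extended by zero off \<open>I\<close>, so that the identities
        below hold on the whole line; \<open>h\<close> is prescribed on \<open>I\<close>
        alone.\<close>
      define k where "k = (\<lambda>t y. f t y * indicator ?I y)"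
      have k: "ennreal (f s y) * indicator ?I y = ennreal (k s y)" "0 \<le> k s y" if "0 < s" for s y
        using f[OF that] by (auto simp: k_def indicator_def)
      have km: "k s \<in> borel_measurable borel" if "0 < s" for s
      proof -
        have "(\<lambda>y. ennreal (k s y)) \<in> borel_measurable borel"
          using distributed_borel_measurable[OF D[OF that]] k(1)[OF that] by simp
        then have "(\<lambda>y. enn2real (ennreal (k s y))) \<in> borel_measurable borel"
          by measurable
        then show ?thesis using k(2)[OF that] by simp
      qed
      have h: "ennreal (h t y) * indicator ?I y = ennreal ((k t y - c * k (a t) y) / (1 - c))" for y
        using assms(11) t by (auto simp: k_def indicator_def)
      \<comment> \<open>This is nonnegativity of the density of \<open>H t\<close>. It is essential
        because \<open>ennreal\<close> sends negative numbers to 0, which would break the additive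
        identity.\<close>
      have kk: "c * k (a t) y \<le> k t y" for y
      proof (cases "y \<in> ?I")
        case True
        have "c * f (a t) y \<le> K * f (a t) y"
          using f[OF a_pos[OF t] True] assms(10) by (intro mult_right_mono) auto
        also have "\<dots> \<le> f t y" by (rule ratio[OF t True])
        finally show ?thesis using True by (simp add: k_def)
      qed (simp add: k_def)
      have X: "emeasure M {\<omega>\<in>space M. X s \<omega> \<in> A} = (\<integral>\<^sup>+y\<in>A. ennreal (k s y) \<partial>lborel)" if "0 < s" for s
        using distributed_emeasure[OF D[OF that], of A] A k(1)[OF that]
        by (simp add: vimage_def Int_def conj_commute)
      have "emeasure M {\<omega>\<in>space M. H t \<omega> \<in> A} =
          (\<integral>\<^sup>+y\<in>A. ennreal ((k t y - c * k (a t) y) / (1 - c)) \<partial>lborel)"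
        unfolding H laws_of_densities_def using t A km[OF t] km[OF a_pos[OF t]]
        by (simp add: h emeasure_density)
      then have "ennreal c * emeasure M {\<omega>\<in>space M. X (a t) \<omega> \<in> A} +
            ennreal (1 - c) * emeasure M {\<omega>\<in>space M. H t \<omega> \<in> A} =
          (\<integral>\<^sup>+y. ennreal c * (ennreal (k (a t) y) * indicator A y) +
            ennreal (1 - c) * (ennreal ((k t y - c * k (a t) y) / (1 - c)) * indicator A y) \<partial>lborel)"
        using X[OF a_pos[OF t]] A km[OF t] km[OF a_pos[OF t]]
        by (subst nn_integral_add) (auto simp: nn_integral_cmult)
      also have "\<dots> = (\<integral>\<^sup>+y\<in>A. ennreal (k t y) \<partial>lborel)"
      proof (rule nn_integral_cong)
        fix y
        \<comment> \<open>The density of \<open>H t\<close> at \<open>y\<close>; solving for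
          \<open>k t y\<close> gives a convex combination with nonnegative terms, which therefore
          lifts to \<open>ennreal\<close>.\<close>
        define v where "v = (k t y - c * k (a t) y) / (1 - c)"
        have v: "0 \<le> v" "k t y = c * k (a t) y + (1 - c) * v" "0 \<le> k (a t) y"
          using c kk[of y] k(2)[OF a_pos[OF t], of y] by (auto simp: v_def)
        have "ennreal c * ennreal (k (a t) y) + ennreal (1 - c) * ennreal v = ennreal (k t y)"
          unfolding v(2) using c v(1,3) by (simp add: ennreal_mult ennreal_plus)
        then show "ennreal c * (ennreal (k (a t) y) * indicator A y) +
            ennreal (1 - c) * (ennreal ((k t y - c * k (a t) y) / (1 - c)) * indicator A y) =
            ennreal (k t y) * indicator A y"
          by (simp add: v_def indicator_def)
      qed
      also have "\<dots> = emeasure M {\<omega>\<in>space M. X t \<omega> \<in> A}" by (rule X[OF t, symmetric])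
      finally have "ennreal (c * prob {\<omega>\<in>space M. X (a t) \<omega> \<in> A} + (1 - c) * prob {\<omega>\<in>space M. H t \<omega> \<in> A}) =
          ennreal (prob {\<omega>\<in>space M. X t \<omega> \<in> A})"
        using c by (simp add: emeasure_eq_measure ennreal_mult ennreal_plus)
      then show ?thesis
        using c by (simp add: prob_G del: ennreal_plus)
    qed
  qed
  moreover have "process_law M mix \<noteq> process_law M X"
    using assms(6) by (intro process_law_mix_neq[OF sa assms(3-5) _ G c]) auto
  ultimately show ?thesis
    by (simp add: fake_version_def Xfake)
qed

end
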